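(* Let $F(t;x,y)\equiv F^{(1)}(t;x,y)=\sum_{I=[P,Q]} \frac{t^{|I|}}{|I|!}\,x^{c(P)}y^{r(Q)}$ be the exponential generating function of labelled $1$-Tamari intervals. Let $z$ and $u$ be two indeterminates, and set $$t=z e^{-2z}\quad\text{and}\quad x=(1+u)e^{-zu}.$$ Then $F(t;x,y)$ becomes a formal power series in $z$ with polynomial coefficients in $u$ and $y$, which is given by $$F(t;x,y)=(1+u)\,e^{2yz}\,[u^{\ge}]\Big(e^{zu(y-1)+zy\bar u}-\bar u\,e^{z\bar u(y-1)+zyu}\Big),$$ with $\bar u=1/u$. Equivalently, $$\frac{F(t;x,y)}{(1+u)e^{2yz}}=\sum_{0\le i\le j}u^{j-i}\frac{z^{i+j}y^i(y-1)^j}{i!\,j!}-\sum_{0\le j<i}u^{i-j-1}\frac{z^{i+j}y^i(y-1)^j}{i!\,j!}.$$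
   Context: A $1$-ballot path of size $n$ is a path on the square grid consisting of north and east unit steps, starting at $(0,0)$, ending at $(n,n)$, and never going below the line $\{x=y\}$. The set $\mathcal{T}_n^{(1)}$ of these paths is partially ordered (the Tamari lattice) by the order whose covering relation is: $Q$ covers $P$ if there exists in $P$ an east step $a$ followed by a north step $b$ such that $Q$ is obtained from $P$ by swapping $a$ and $S$, where $S$ is the shortest factor of $P$ (sequence of consecutive steps) that begins with $b$ and is a (translated) $1$-ballot path. A $1$-Tamari interval $I=[P,Q]$ is an interval of this order, given by a pair $P\preceq Q$ in $\mathcal{T}_n^{(1)}$; its size is $|I|=n$. It is labelled if the north steps of the upper path $Q$ are labelled with $1,\dots,n$ (each label used once) so that labels increase along any sequence of consecutive north steps. $c(P)$ is the number of contacts of $P$, i.e. of vertices of $P$ lying on the line $\{x=y\}$ (the path of size $0$ has one contact), and $r(Q)$ is the length of the initial run of north steps of $Q$. The sum defining $F^{(1)}$ runs over all labelled $1$-Tamari intervals of all sizes $n\ge 0$. For a Laurent polynomial $P(u)=\sum_{i\in\mathbb{Z}}P_iu^i$, its non-negative part is $[u^{\ge}]P(u)=\sum_{i\ge 0}P_iu^i$; this is extended by linearity (coefficientwise) to power series whose coefficients are Laurent polynomials in $u$. *)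

theory Defs
  imports
    "HOL-Analysis.Analysis"
    "HOL-Computational_Algebra.Computational_Algebra"
    "HOL-Library.Poly_Mapping"
begin

subsection \<open>Ballot paths and the Tamari order\<close>

datatype step = North | East

definition ballot_path :: "nat \<Rightarrow> step list \<Rightarrow> bool" where
  "ballot_path n P \<longleftrightarrow>
     count_list P North = n \<and> count_list P East = n \<and>
     (\<forall>k \<le> length P. count_list (take k P) East \<le> count_list (take k P) North)"

text \<open>In the decomposition below, the displayed East step is the step \<open>a\<close>, the first step of \<open>S\<close>
  is the step \<open>b\<close>, and minimality of \<open>S\<close> is among the nonempty factors starting at \<open>b\<close>.\<close>

definition tamari_covers :: "step list \<Rightarrow> step list \<Rightarrow> bool" where
  "tamari_covers P Q \<longleftrightarrow>
     (\<exists>U S V. P = U @ [East] @ S @ V \<and> Q = U @ S @ [East] @ V \<and>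
        S \<noteq> [] \<and> hd S = North \<and> (\<exists>k. ballot_path k S) \<and>
        (\<forall>l. 0 < l \<and> l < length S \<longrightarrow> \<not> (\<exists>k. ballot_path k (take l S))))"

definition tamari_le :: "nat \<Rightarrow> step list \<Rightarrow> step list \<Rightarrow> bool" where
  "tamari_le n P Q \<longleftrightarrow> ballot_path n P \<and> ballot_path n Q \<and> tamari_covers\<^sup>*\<^sup>* P Q"

subsection \<open>Labelled intervals and their generating function\<close>

definition contacts :: "step list \<Rightarrow> nat" where
  "contacts P = card {k. k \<le> length P \<and> count_list (take k P) North = count_list (take k P) East}"

definition initial_run :: "step list \<Rightarrow> nat" where
  "initial_run Q = length (takeWhile (\<lambda>s. s = North) Q)"

text \<open>A labelling is the list of the labels of the north steps, from the first to the last one; a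
  north step at position \<open>k\<close> of the path has index \<open>count_list (take k Q) North\<close> in that list.\<close>

definition labelling :: "nat \<Rightarrow> step list \<Rightarrow> nat list \<Rightarrow> bool" where
  "labelling n Q w \<longleftrightarrow>
     length w = n \<and> distinct w \<and> set w = {1..n} \<and>
     (\<forall>k. Suc k < length Q \<and> Q ! k = North \<and> Q ! Suc k = North \<longrightarrow>
        w ! count_list (take k Q) North < w ! count_list (take (Suc k) Q) North)"

definition labelled_intervals :: "nat \<Rightarrow> (step list \<times> step list \<times> nat list) set" where
  "labelled_intervals n = {(P, Q, w). tamari_le n P Q \<and> labelling n Q w}"

text \<open>A power series in \<open>t\<close>; in its coefficients the outer polynomial variable is \<open>y\<close> and the inner
  one is \<open>x\<close>.\<close>

definition tamari_gf :: "rat poly poly fps" where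
  "tamari_gf = Abs_fps (\<lambda>n. \<Sum>(P, Q, w) \<in> labelled_intervals n.
     monom (monom (1 / fact n) (contacts P)) (initial_run Q))"

subsection \<open>Power series in \<open>z\<close> over Laurent polynomials in \<open>u\<close>\<close>

text \<open>The elements of \<open>int \<Rightarrow>\<^sub>0 rat poly\<close>, with the convolution product, are the Laurent polynomials
  in \<open>u\<close> whose coefficients are polynomials in \<open>y\<close>.\<close>

type_synonym laurent = "int \<Rightarrow>\<^sub>0 rat poly"

definition zv :: "laurent fps" where "zv = fps_X"
definition uv :: "laurent fps" where "uv = fps_const (Poly_Mapping.single 1 1)"
definition ubar :: "laurent fps" where "ubar = fps_const (Poly_Mapping.single (-1) 1)"
definition yv :: "laurent fps" where "yv = fps_const (Poly_Mapping.single 0 [:0, 1:])"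

definition rat_laurent :: "rat \<Rightarrow> laurent" where
  "rat_laurent q = Poly_Mapping.single 0 [:q:]"

definition rat_fps :: "rat \<Rightarrow> laurent fps" where
  "rat_fps q = fps_const (rat_laurent q)"

text \<open>The library's \<open>fps_exp\<close> requires coefficients in a field. As with any composition of formal
  power series, \<open>exp_fps G\<close> is meaningful only when \<open>G\<close> has zero constant term in \<open>z\<close>.\<close>

definition exp_fps :: "laurent fps \<Rightarrow> laurent fps" where
  "exp_fps G = fps_compose (Abs_fps (\<lambda>n. rat_laurent (1 / fact n))) G"

definition eval_xy :: "laurent fps \<Rightarrow> laurent fps \<Rightarrow> rat poly poly \<Rightarrow> laurent fps" where
  "eval_xy x y p = poly (map_poly (\<lambda>q. poly (map_poly rat_fps q) x) p) y"

definition nonneg_part :: "laurent \<Rightarrow> laurent" where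
  "nonneg_part p = (\<Sum>i \<in> {i \<in> Poly_Mapping.keys p. 0 \<le> i}.
     Poly_Mapping.single i (Poly_Mapping.lookup p i))"

definition nonneg_part_fps :: "laurent fps \<Rightarrow> laurent fps" where
  "nonneg_part_fps G = Abs_fps (\<lambda>n. nonneg_part (fps_nth G n))"

definition polynomial_in_u :: "laurent \<Rightarrow> bool" where
  "polynomial_in_u p \<longleftrightarrow> (\<forall>i \<in> Poly_Mapping.keys p. 0 \<le> i)"

end

theory Submission
  imports Defs
begin

text \<open>The series is pinned down by a functional equation, and the closed form is checked to satisfy it.

\<^bold>\<open>Functional equation.\<close> A nonempty ballot path is uniquely \<open>N l E r\<close> with ballot paths \<open>l\<close> and
\<open>r\<close>, so ballot paths are binary trees, and the covering relation becomes tree rotation together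
with covers inside either subtree. An interval with upper path \<open>N q1 E q2\<close> is then described by
its lower path \<open>N a E b c\<close>, where \<open>[a b, q1]\<close> and \<open>[c, q2]\<close> are arbitrary intervals
(\<open>tle_Node_iff\<close>). Splitting a lower path \<open>p1\<close> as \<open>a b\<close> means choosing one of its contacts, and
the number of contacts of \<open>b\<close> then runs through \<open>1, ..., c(p1)\<close>; the geometric sum
\<open>x + ... + x^c = x (x^c - 1) / (x - 1)\<close> produces a divided difference. A path has
\<open>n! / (r1! r2! ...)\<close> labellings, where the \<open>ri\<close> are the lengths of its runs of north steps
(\<open>card_labelling\<close>), and prepending one north step to the first run divides the weight by the new
length of that run, which is undone by differentiating in \<open>y\<close>. Altogether
\<open>(x - 1) dF/dy (x, y) = t x F(x, 1) (F(x, y) - F(1, y))\<close> and \<open>F(x, 0) = x\<close>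
(\<open>interval_series_Suc\<close> is the coefficient of \<open>t^(n+1)\<close>).

\<^bold>\<open>Uniqueness.\<close> After the substitution, \<open>x = 1\<close> corresponds to \<open>u = 0\<close>. As
\<open>x - 1 = u + O(z)\<close> and \<open>t = O(z)\<close>, the equation determines the derivative in \<open>y\<close> of each
coefficient in \<open>z\<close> from the previous coefficients, and the value at \<open>y = 0\<close> fixes the
constant of integration (\<open>solution_unique\<close>).

\<^bold>\<open>Verification.\<close> Let \<open>W\<close> be the Laurent series whose non-negative part \<open>H\<close> appears in the
theorem, and \<open>G = (1 + u) e^(2yz) H\<close>. Both exponentials in \<open>W\<close> have the logarithmic derivative
\<open>z (u + 1/u)\<close> in \<open>y\<close>, and \<open>W(1/u) = - u W(u)\<close>, so that the coefficients of \<open>1/u\<close> and of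
\<open>u^0\<close> in \<open>W\<close> are opposite. The first property gives a linear equation for \<open>W\<close>; the second
makes the boundary terms, which arise when the non-negative part is taken, combine into
\<open>dG/dy = z (1 + u) (1 + 1/u) (G - G(u = 0))\<close> (\<open>dy_tamari_sol\<close>). At \<open>y = 1\<close> the series \<open>H\<close> collapses
to \<open>1 - (e^(zu) - 1) / u\<close>, and with the given \<open>t\<close> and \<open>x\<close> this yields
\<open>t x G(y = 1) = (x - 1) z (1 + u) (1 + 1/u)\<close>, which turns the linear equation for \<open>G\<close> into
the quadratic functional equation of \<open>F\<close>.\<close>

section \<open>Ballot paths as binary trees and the Tamari order on trees\<close>

datatype btree = Leaf | Node btree btree

fun nodes :: "btree \<Rightarrow> nat" where
  "nodes Leaf = 0"
| "nodes (Node l r) = Suc (nodes l + nodes r)"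

fun tree_path :: "btree \<Rightarrow> step list" where
  "tree_path Leaf = []"
| "tree_path (Node l r) = North # tree_path l @ East # tree_path r"

lemma count_path [simp]:
  "count_list (tree_path t) North = nodes t" "count_list (tree_path t) East = nodes t"
  by (induction t) auto

lemma length_path [simp]: "length (tree_path t) = 2 * nodes t"
  by (induction t) auto

lemma tree_path_prefix_count: "tree_path t = U @ V \<Longrightarrow> count_list U East \<le> count_list U North"
proof (induction t arbitrary: U V)
  case (Node l r)
  show ?case
  proof (cases U)
    case (Cons a U')
    then have "a = North" and "tree_path l @ East # tree_path r = U' @ V"
      using Node.prems by auto
    then consider W where "tree_path l = U' @ W" | W where "U' = tree_path l @ East # W" "tree_path r = W @ V"
      by (auto simp: append_eq_append_conv2 append_eq_Cons_conv Cons_eq_append_conv)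
    then show ?thesis
    proof cases
      case 1
      then show ?thesis using Node.IH(1)[of U' W] \<open>a = North\<close> Cons by simp
    next
      case 2
      then show ?thesis using Node.IH(2)[of W V] \<open>a = North\<close> Cons by simp
    qed
  qed simp
qed simp

text \<open>As the whole path is balanced, this is the prefix inequality read from the other end.\<close>

lemma tree_path_suffix_count:
  assumes "tree_path t = U @ V" shows "count_list V North \<le> count_list V East"
  using tree_path_prefix_count[OF assms] arg_cong[OF assms, of "\<lambda>xs. count_list xs North"]
    arg_cong[OF assms, of "\<lambda>xs. count_list xs East"] by simp

lemma ballot_path_tree_path: "ballot_path (nodes t) (tree_path t)"
  unfolding ballot_path_def
  using tree_path_prefix_count[of t "take k (tree_path t)" "drop k (tree_path t)" for k] by auto

text \<open>A path with more east than north steps has a first step below the axis, and what precedes it is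
balanced. Finding the tree of that part by recursion only needs this lemma for the shorter paths
that remain after each return, which is why the path is allowed to continue arbitrarily.\<close>

lemma descent_below_axis:
  "count_list P North < count_list P East \<Longrightarrow> \<exists>t X. P = tree_path t @ East # X"
proof (induction P rule: measure_induct_rule[of length])
  case (less P)
  show ?case
  proof (cases P)
    case Nil
    then show ?thesis using less.prems by simp
  next
    case (Cons a P')
    show ?thesis
    proof (cases a)
      case East
      then have "P = tree_path Leaf @ East # P'" using Cons by simp
      then show ?thesis by blast
    next
      case North
      then have "count_list P' North < count_list P' East" using Cons less.prems by simp
      then obtain l X where l: "P' = tree_path l @ East # X" using less.IH[of P'] Cons by auto
      then have "count_list X North < count_list X East"
        using less.prems Cons North by simp
      moreover have "length X < length P" using Cons l by simp
      ultimately obtain r Y where "X = tree_path r @ East # Y" using less.IH by blast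
      then have "P = tree_path (Node l r) @ East # Y" using Cons North l by simp
      then show ?thesis by blast
    qed
  qed
qed

text \<open>Every ballot path is parsed by appending one east step, which is then the first one to go below
the axis.\<close>

lemma ballot_path_iff: "ballot_path n P \<longleftrightarrow> (\<exists>t. P = tree_path t \<and> nodes t = n)"
proof
  assume P: "ballot_path n P"
  then have "count_list (P @ [East]) North < count_list (P @ [East]) East"
    by (simp add: ballot_path_def)
  then obtain t X where tX: "P @ [East] = tree_path t @ East # X" using descent_below_axis by blast
  have "X = []"
  proof (rule ccontr)
    assume "X \<noteq> []"
    then obtain X' where "P = tree_path t @ East # X'" using tX
      by (cases X rule: rev_cases) auto
    moreover have "count_list (take (length (tree_path t) + 1) P) East
        \<le> count_list (take (length (tree_path t) + 1) P) North"
    proof -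
      have "length (tree_path t) + 1 \<le> length P" using calculation by simp
      then show ?thesis using P unfolding ballot_path_def by blast
    qed
    ultimately show False by simp
  qed
  then show "\<exists>t. P = tree_path t \<and> nodes t = n" using tX P by (auto simp: ballot_path_def)
qed (use ballot_path_tree_path in auto)

text \<open>Ballot paths followed by the step that leaves the upper half plane form a prefix code; this is
the uniqueness of the first-return decomposition.\<close>

lemma tree_path_East_cancel:
  "tree_path s @ East # X = tree_path t @ East # Y \<longleftrightarrow> s = t \<and> X = Y"
proof (induction s arbitrary: t X Y)
  case Leaf
  then show ?case by (cases t) auto
next
  case (Node l r)
  then show ?case by (cases t) auto
qed

lemma tree_path_inject: "tree_path s = tree_path t \<longleftrightarrow> s = t"
  using tree_path_East_cancel[of s "[]" t "[]"] by simp

text \<open>Grafting is the concatenation of paths, see \<open>tree_path_graft\<close>.\<close>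

fun graft :: "btree \<Rightarrow> btree \<Rightarrow> btree" where
  "graft Leaf t = t"
| "graft (Node l r) t = Node l (graft r t)"

lemma tree_path_graft [simp]: "tree_path (graft s t) = tree_path s @ tree_path t"
  by (induction s) auto

lemma graft_Leaf [simp]: "graft t Leaf = t"
  by (induction t) auto

lemma graft_assoc: "graft (graft a b) c = graft a (graft b c)"
  by (induction a) auto

lemma nodes_graft [simp]: "nodes (graft a b) = nodes a + nodes b"
  by (induction a) auto

text \<open>In \<open>swap\<close> the east step that closes \<open>a\<close> moves past the first excursion \<open>N c E\<close> to its
right; the other rules let a cover take place inside one of the two factors of \<open>N l E r\<close>.\<close>

inductive cover :: "btree \<Rightarrow> btree \<Rightarrow> bool" where
  left: "cover l l' \<Longrightarrow> cover (Node l r) (Node l' r)"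
| right: "cover r r' \<Longrightarrow> cover (Node l r) (Node l r')"
| swap: "cover (Node a (Node c d)) (Node (graft a (Node c Leaf)) d)"

text \<open>A nonempty ballot path without a proper nonempty ballot prefix is a single excursion \<open>N c E\<close>.\<close>

lemma tamari_covers_path_iff:
  "tamari_covers P Q \<longleftrightarrow> (\<exists>U c V. P = U @ East # tree_path (Node c Leaf) @ V
     \<and> Q = U @ tree_path (Node c Leaf) @ East # V)"
proof
  assume "tamari_covers P Q"
  then obtain U S V k where P: "P = U @ [East] @ S @ V" and Q: "Q = U @ S @ [East] @ V"
    and S: "S \<noteq> []" "ballot_path k S"
    and min: "\<forall>l. 0 < l \<and> l < length S \<longrightarrow> \<not> (\<exists>k. ballot_path k (take l S))"
    unfolding tamari_covers_def by blast
  from S obtain s where s: "S = tree_path s" "nodes s = k" by (auto simp: ballot_path_iff)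
  then obtain c d where cd: "s = Node c d" using S by (cases s) auto
  have "take (length (tree_path (Node c Leaf))) S = tree_path (Node c Leaf)" by (simp add: s cd)
  then have "\<exists>k. ballot_path k (take (length (tree_path (Node c Leaf))) S)"
    using ballot_path_tree_path by metis
  then have "\<not> length (tree_path (Node c Leaf)) < length S" using min by auto
  then have "d = Leaf" using s cd by (cases d) auto
  then show "\<exists>U c V. P = U @ East # tree_path (Node c Leaf) @ V
     \<and> Q = U @ tree_path (Node c Leaf) @ East # V"
    using P Q s cd by auto
next
  assume "\<exists>U c V. P = U @ East # tree_path (Node c Leaf) @ V
     \<and> Q = U @ tree_path (Node c Leaf) @ East # V"
  then obtain U c V where PQ: "P = U @ East # tree_path (Node c Leaf) @ V"
     "Q = U @ tree_path (Node c Leaf) @ East # V" by blast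
  define S where "S = tree_path (Node c Leaf)"
  have min: "\<not> (\<exists>k. ballot_path k (take l S))" if l: "0 < l" "l < length S" for l
  proof
    assume "\<exists>k. ballot_path k (take l S)"
    then obtain t where t: "take l S = tree_path t" by (auto simp: ballot_path_iff)
    then have S: "S = tree_path t @ drop l S" by (metis append_take_drop_id)
    have "t \<noteq> Leaf" using t l by auto
    then obtain a b where "t = Node a b" by (cases t) auto
    then have "tree_path c @ East # [] = tree_path a @ East # (tree_path b @ drop l S)"
      using S by (simp add: S_def)
    then have "drop l S = []" by (simp only: tree_path_East_cancel) simp
    then show False using l by simp
  qed
  show "tamari_covers P Q"
    unfolding tamari_covers_def
    using PQ ballot_path_tree_path[of "Node c Leaf"] min
    by (intro exI[of _ U] exI[of _ S] exI[of _ V]) (auto simp: S_def)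
qed

lemma tamari_covers_context:
  "tamari_covers P Q \<Longrightarrow> tamari_covers (U @ P @ V) (U @ Q @ V)"
proof -
  assume "tamari_covers P Q"
  then obtain U' c V' where "P = U' @ East # tree_path (Node c Leaf) @ V'"
    "Q = U' @ tree_path (Node c Leaf) @ East # V'" unfolding tamari_covers_path_iff by blast
  then show "tamari_covers (U @ P @ V) (U @ Q @ V)"
    unfolding tamari_covers_path_iff
    by (intro exI[of _ "U @ U'"] exI[of _ c] exI[of _ "V' @ V"]) simp
qed

lemma cover_imp_tamari_covers: "cover s t \<Longrightarrow> tamari_covers (tree_path s) (tree_path t)"
proof (induction rule: cover.induct)
  case (left l l' r)
  then show ?case
    using tamari_covers_context[of "tree_path l" "tree_path l'" "[North]" "East # tree_path r"] by simp
next
  case (right r r' l)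
  then show ?case
    using tamari_covers_context[of "tree_path r" "tree_path r'" "North # tree_path l @ [East]" "[]"] by simp
next
  case (swap a c d)
  show ?case unfolding tamari_covers_path_iff
    by (intro exI[of _ "North # tree_path a"] exI[of _ c] exI[of _ "tree_path d"]) simp
qed

text \<open>A ballot factor cannot straddle the east step that closes the factor \<open>l\<close> of \<open>N l E R\<close>: the
part of it before that step is a suffix of \<open>l\<close>, which has at least as many east as north steps,
and with one more east step it would go below its starting level.\<close>

lemma ballot_factor_within:
  assumes "tree_path l = U @ Z" and "Z @ East # R = tree_path m @ V"
  shows "\<exists>V'. Z = tree_path m @ V' \<and> V = V' @ East # R"
proof -
  consider V' where "Z = tree_path m @ V'" "V = V' @ East # R"
    | M where "(Z @ [East]) @ M = tree_path m"
    using assms(2) by (auto simp: append_eq_append_conv2 Cons_eq_append_conv)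
  then show ?thesis
  proof cases
    case 2
    then show ?thesis
      \<comment> \<open>The prefix \<open>Z E\<close> of a ballot path has at least as many north as east steps, the suffix \<open>Z\<close> has at most as many.\<close>
      using tree_path_prefix_count[OF 2[symmetric]] tree_path_suffix_count[OF assms(1)] by simp
  qed blast
qed

text \<open>The three cases are the position of the displaced east step in \<open>N l E r\<close>: it is the closing step
of \<open>l\<close>, or it belongs to \<open>r\<close>, or it belongs to \<open>l\<close>.\<close>

lemma tamari_covers_imp_cover:
  "tree_path s = U @ East # tree_path (Node c Leaf) @ V \<Longrightarrow>
     \<exists>t. U @ tree_path (Node c Leaf) @ East # V = tree_path t \<and> cover s t"
proof (induction s arbitrary: U V)
  case Leaf
  then show ?case by simp
next
  case (Node l r)
  let ?S = "tree_path (Node c Leaf)"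
  obtain U' where U: "U = North # U'" and *: "tree_path l @ East # tree_path r = U' @ East # ?S @ V"
    using Node.prems by (cases U) auto
  then consider "U' = tree_path l" "tree_path r = ?S @ V"
    | U'' where "U' = tree_path l @ East # U''" "tree_path r = U'' @ East # ?S @ V"
    | Z where "tree_path l = U' @ East # Z" "Z @ East # tree_path r = ?S @ V"
    by (auto simp: append_eq_append_conv2 Cons_eq_append_conv append_eq_Cons_conv)
  then show ?case
  proof cases
    case 1
    then obtain a d where "r = Node a d" by (cases r) auto
    then have "tree_path a @ East # tree_path d = tree_path c @ East # V" using 1 by simp
    then have "a = c" "tree_path d = V" by (simp_all add: tree_path_East_cancel)
    then have "U @ ?S @ East # V = tree_path (Node (graft l (Node c Leaf)) d)"
      using U 1 by simp
    moreover have "cover (Node l r) (Node (graft l (Node c Leaf)) d)"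
      using \<open>r = Node a d\<close> \<open>a = c\<close> by (simp add: cover.swap)
    ultimately show ?thesis by blast
  next
    case 2
    then obtain t where t: "U'' @ ?S @ East # V = tree_path t" "cover r t" using Node.IH(2) by blast
    have "U @ ?S @ East # V = tree_path (Node l t)" using 2 t U by simp
    then show ?thesis using t cover.right by blast
  next
    case 3
    then obtain V' where V': "Z = ?S @ V'" "V = V' @ East # tree_path r"
      using ballot_factor_within[of l "U' @ [East]" Z "tree_path r" "Node c Leaf" V] by auto
    then obtain t where t: "U' @ ?S @ East # V' = tree_path t" "cover l t"
      using Node.IH(1)[of U' V'] 3 by auto
    have "U @ ?S @ East # V = tree_path (Node t r)" using V' t(1)[symmetric] U by simp
    then show ?thesis using t cover.left by blast
  qed
qed

lemma tamari_covers_path_left: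
  "tamari_covers (tree_path s) Q \<longleftrightarrow> (\<exists>t. Q = tree_path t \<and> cover s t)"
  (is "?L = ?R")
proof
  assume ?L
  then obtain U c V where "tree_path s = U @ East # tree_path (Node c Leaf) @ V"
    "Q = U @ tree_path (Node c Leaf) @ East # V" unfolding tamari_covers_path_iff by blast
  then show ?R using tamari_covers_imp_cover[of s U c V] by simp
qed (auto intro: cover_imp_tamari_covers)

abbreviation tle :: "btree \<Rightarrow> btree \<Rightarrow> bool" (infix "\<sqsubseteq>" 50) where
  "s \<sqsubseteq> t \<equiv> cover\<^sup>*\<^sup>* s t"

lemma tamari_covers_rtranclp_path:
  "tamari_covers\<^sup>*\<^sup>* (tree_path s) Q \<longleftrightarrow> (\<exists>t. Q = tree_path t \<and> s \<sqsubseteq> t)"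
proof
  assume "tamari_covers\<^sup>*\<^sup>* (tree_path s) Q"
  then show "\<exists>t. Q = tree_path t \<and> s \<sqsubseteq> t"
  proof (induction rule: rtranclp_induct)
    case base
    show ?case by blast
  next
    case (step Q R)
    then obtain t where "Q = tree_path t" "s \<sqsubseteq> t" by blast
    moreover from this step(2) obtain u where "R = tree_path u" "cover t u"
      by (auto simp: tamari_covers_path_left)
    ultimately have "s \<sqsubseteq> u" by (simp add: rtranclp.rtrancl_into_rtrancl)
    then show ?case using \<open>R = tree_path u\<close> by blast
  qed
next
  assume "\<exists>t. Q = tree_path t \<and> s \<sqsubseteq> t"
  then obtain t where "Q = tree_path t" "s \<sqsubseteq> t" by blast
  from this(2) have "tamari_covers\<^sup>*\<^sup>* (tree_path s) (tree_path t)"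
    by (induction rule: rtranclp_induct)
      (auto intro: rtranclp.rtrancl_into_rtrancl cover_imp_tamari_covers)
  then show "tamari_covers\<^sup>*\<^sup>* (tree_path s) Q" using \<open>Q = tree_path t\<close> by simp
qed

lemma cover_nodes: "cover s t \<Longrightarrow> nodes t = nodes s"
  by (induction rule: cover.induct) auto

lemma tle_nodes: "s \<sqsubseteq> t \<Longrightarrow> nodes t = nodes s"
  by (induction rule: rtranclp_induct) (auto dest: cover_nodes)

lemma tamari_le_iff:
  "tamari_le n P Q \<longleftrightarrow> (\<exists>p q. P = tree_path p \<and> Q = tree_path q \<and> p \<sqsubseteq> q \<and> nodes q = n)"
  (is "?L = ?R")
proof
  assume ?L
  then obtain p where "P = tree_path p" "tamari_covers\<^sup>*\<^sup>* (tree_path p) Q" "nodes p = n"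
    unfolding tamari_le_def ballot_path_iff by blast
  then show ?R unfolding tamari_covers_rtranclp_path using tle_nodes by auto
next
  assume ?R
  then obtain p q where "P = tree_path p" "Q = tree_path q" "p \<sqsubseteq> q" "nodes q = n" by blast
  then show ?L unfolding tamari_le_def
    using tamari_covers_rtranclp_path[of p Q] tle_nodes[of p q]
      ballot_path_tree_path[of p] ballot_path_tree_path[of q] by auto
qed

section \<open>First-return decomposition of Tamari intervals\<close>

lemma cover_graft_left: "cover a a' \<Longrightarrow> cover (graft a b) (graft a' b)"
  by (induction rule: cover.induct) (auto simp: intro: cover.intros)

lemma cover_graft_right: "cover b b' \<Longrightarrow> cover (graft a b) (graft a b')"
  by (induction a) (auto intro: cover.intros)

lemma tle_map:
  assumes "s \<sqsubseteq> t" and "\<And>s t. cover s t \<Longrightarrow> cover (f s) (f t)"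
  shows "f s \<sqsubseteq> f t"
  using assms(1) by (induction rule: rtranclp_induct)
    (auto intro: rtranclp.rtrancl_into_rtrancl assms(2))

lemma tle_Node:
  assumes "l \<sqsubseteq> l'" "r \<sqsubseteq> r'" shows "Node l r \<sqsubseteq> Node l' r'"
proof -
  have "Node l r \<sqsubseteq> Node l' r" by (rule tle_map[OF assms(1)]) (rule cover.left)
  also have "Node l' r \<sqsubseteq> Node l' r'" by (rule tle_map[OF assms(2)]) (rule cover.right)
  finally show ?thesis .
qed

text \<open>The east step that closes \<open>a\<close> moves past the excursions of \<open>b\<close> one after the other.\<close>

lemma tle_move_left: "Node a (graft b c) \<sqsubseteq> Node (graft a b) c"
proof (induction b arbitrary: a)
  case (Node l r)
  have "cover (Node a (graft (Node l r) c)) (Node (graft a (Node l Leaf)) (graft r c))"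
    by (simp add: cover.swap)
  also have "Node (graft a (Node l Leaf)) (graft r c) \<sqsubseteq> Node (graft (graft a (Node l Leaf)) r) c"
    by (rule Node.IH(2))
  finally show ?case by (simp add: graft_assoc)
qed simp

text \<open>A cover only raises the path, so a contact of its result is also a contact of the original path,
and the change takes place on one side of it.\<close>

lemma cover_graft_cases:
  "cover s (graft b c) \<Longrightarrow> (\<exists>b'. s = graft b' c \<and> cover b' b) \<or> (\<exists>c'. s = graft b c' \<and> cover c' c)"
proof (induction b arbitrary: s)
  case (Node x y)
  from Node.prems have "cover s (Node x (graft y c))" by simp
  then show ?case
  proof cases
    case (left l)
    then have "s = graft (Node l y) c" by simp
    then show ?thesis using left cover.left by blast
  next
    case (right r)
    from Node.IH(2)[OF right(2)] show ?thesis
    proof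
      assume "\<exists>b'. r = graft b' c \<and> cover b' y"
      then obtain b' where "r = graft b' c" "cover b' y" by blast
      then have "s = graft (Node x b') c" "cover (Node x b') (Node x y)"
        using right by (auto intro: cover.right)
      then show ?thesis by blast
    next
      assume "\<exists>c'. r = graft y c' \<and> cover c' c"
      then show ?thesis using right by auto
    qed
  next
    case (swap a d)
    then have "s = graft (Node a (Node d y)) c" by simp
    moreover have "cover (Node a (Node d y)) (Node x y)" using swap cover.swap by auto
    ultimately show ?thesis by blast
  qed
qed simp

text \<open>This is the decomposition of intervals. Sufficiency: first move the closing east step of \<open>a\<close>
past \<open>b\<close>, then work inside the two factors. Necessity: the right-hand side holds for
\<open>p = Node q1 q2\<close> with \<open>b\<close> empty, and it is inherited by anything that \<open>p\<close> covers. The tree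
\<open>graft a b\<close> stays the same when the displaced step is the closing step of \<open>a\<close> or lies in \<open>c\<close>, and is
replaced by a tree that it covers otherwise.\<close>

lemma tle_Node_iff:
  "p \<sqsubseteq> Node q1 q2 \<longleftrightarrow> (\<exists>a b c. p = Node a (graft b c) \<and> graft a b \<sqsubseteq> q1 \<and> c \<sqsubseteq> q2)"
proof
  assume "p \<sqsubseteq> Node q1 q2"
  then show "\<exists>a b c. p = Node a (graft b c) \<and> graft a b \<sqsubseteq> q1 \<and> c \<sqsubseteq> q2"
  proof (induction rule: converse_rtranclp_induct)
    case base
    \<comment> \<open>Reflexivity: the first returns of both paths coincide.\<close>
    show ?case by (intro exI[of _ q1] exI[of _ Leaf] exI[of _ q2]) simp
  next
    case (step p p')
    then obtain a b c where p': "p' = Node a (graft b c)"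
      and le: "graft a b \<sqsubseteq> q1" "c \<sqsubseteq> q2" by blast
    from step(1)[unfolded p'] show ?case
    proof cases
      case (left l)
      then have "graft l b \<sqsubseteq> q1" using le cover_graft_left[of l a b] by (meson converse_rtranclp_into_rtranclp)
      then show ?thesis using left le by blast
    next
      case (right r)
      from cover_graft_cases[OF right(2)] show ?thesis
      proof
        assume "\<exists>b'. r = graft b' c \<and> cover b' b"
        then obtain b' where "r = graft b' c" "cover b' b" by blast
        then have "graft a b' \<sqsubseteq> q1"
          using le cover_graft_right[of b' b a] by (meson converse_rtranclp_into_rtranclp)
        then show ?thesis using right le \<open>r = graft b' c\<close> by blast
      next
        assume "\<exists>c'. r = graft b c' \<and> cover c' c"
        then obtain c' where "r = graft b c'" "cover c' c" by blast
        then have "c' \<sqsubseteq> q2" using le by (meson converse_rtranclp_into_rtranclp)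
        then show ?thesis using right le \<open>r = graft b c'\<close> by blast
      qed
    next
      case (swap a' d)
      then have "p = Node a' (graft (Node d b) c)" "graft a' (Node d b) = graft a b"
        by (simp_all add: graft_assoc)
      then show ?thesis using le by metis
    qed
  qed
next
  assume "\<exists>a b c. p = Node a (graft b c) \<and> graft a b \<sqsubseteq> q1 \<and> c \<sqsubseteq> q2"
  then obtain a b c where p: "p = Node a (graft b c)" and le: "graft a b \<sqsubseteq> q1" "c \<sqsubseteq> q2" by blast
  have "p \<sqsubseteq> Node (graft a b) c" unfolding p by (rule tle_move_left)
  also have "\<dots> \<sqsubseteq> Node q1 q2" using le by (rule tle_Node)
  finally show "p \<sqsubseteq> Node q1 q2" .
qed

section \<open>Contacts, initial run and labellings of a path\<close>

fun touches :: "btree \<Rightarrow> nat" where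
  "touches Leaf = 1"
| "touches (Node l r) = Suc (touches r)"

fun first_run :: "btree \<Rightarrow> nat" where
  "first_run Leaf = 0"
| "first_run (Node l r) = Suc (first_run l)"

text \<open>The reciprocal of the product of the factorials of the run lengths (\<open>weight_eq\<close>), in a form adapted to the
first-return decomposition: in \<open>N l E r\<close> the first run of \<open>l\<close> gains one step, while
the first run of \<open>r\<close> stays a run of its own because an east step precedes it.\<close>

fun weight :: "btree \<Rightarrow> rat" where
  "weight Leaf = 1"
| "weight (Node l r) = weight l * weight r / of_nat (Suc (first_run l))"

text \<open>Apart from the origin, \<open>N l E r\<close> touches the diagonal only in the part \<open>r\<close>, since the part
\<open>N l\<close> stays strictly above it.\<close>

lemma contacts_tree_path: "contacts (tree_path t) = touches t"
proof (induction t)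
  case Leaf
  then show ?case by (simp add: contacts_def)
next
  case (Node l r)
  define C where "C P = {k. k \<le> length P \<and>
    count_list (take k P) North = count_list (take k P) East}" for P
  let ?P = "tree_path (Node l r)"
  let ?f = "\<lambda>k. 2 * nodes l + 2 + k"
  have C_Node: "C ?P = insert 0 (?f ` C (tree_path r))"
  proof (intro equalityI subsetI)
    fix k assume k: "k \<in> C ?P"
    show "k \<in> insert 0 (?f ` C (tree_path r))"
    proof (cases k)
      case (Suc k')
      consider "k' \<le> 2 * nodes l" | j where "k' = 2 * nodes l + Suc j"
        using less_imp_Suc_add[of "2 * nodes l" k'] by fastforce
      then show ?thesis
      proof cases
        case 1
        then have "take k ?P = North # take k' (tree_path l)" using Suc by simp
        moreover have "count_list (take k' (tree_path l)) East
            \<le> count_list (take k' (tree_path l)) North"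
          by (rule tree_path_prefix_count[of l _ "drop k' (tree_path l)"]) simp
        ultimately show ?thesis using k by (simp add: C_def)
      next
        case 2
        then have "take k ?P = North # tree_path l @ East # take j (tree_path r)" using Suc by simp
        then have "j \<in> C (tree_path r)" using k 2 Suc by (simp add: C_def)
        then show ?thesis using 2 Suc by auto
      qed
    qed simp
  next
    fix k assume "k \<in> insert 0 (?f ` C (tree_path r))"
    then show "k \<in> C ?P" by (auto simp: C_def)
  qed
  moreover have "finite (C (tree_path r))" unfolding C_def by simp
  moreover have "card (?f ` C (tree_path r)) = card (C (tree_path r))"
    by (rule card_image) (simp add: inj_on_def)
  ultimately have "card (C ?P) = Suc (card (C (tree_path r)))"
    by (subst C_Node) (auto simp: card_insert_if)
  then show ?case using Node.IH(2) by (simp add: contacts_def C_def)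
qed

text \<open>Each east step starts a new run, possibly of length zero; such empty runs contribute the
factor \<open>0! = 1\<close> and make the list additive under concatenation at an east step.\<close>

fun runs :: "step list \<Rightarrow> nat list" where
  "runs [] = [0]"
| "runs (East # P) = 0 # runs P"
| "runs (North # P) = Suc (hd (runs P)) # tl (runs P)"

lemma runs_not_Nil [simp]: "runs P \<noteq> []"
  by (induction P rule: runs.induct) auto

lemma runs_append_East: "runs (P @ East # Q) = runs P @ runs Q"
  by (induction P rule: runs.induct) auto

lemma hd_runs: "hd (runs P) = initial_run P"
  by (induction P rule: runs.induct) (auto simp: initial_run_def)

lemma sum_list_runs: "sum_list (runs P) = count_list P North"
proof (induction P rule: runs.induct)
  case (3 P)
  then show ?case by (cases "runs P") auto
qed auto

lemma hd_runs_tree_path: "hd (runs (tree_path t)) = first_run t"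
  by (induction t) (auto simp: runs_append_East)

lemma initial_run_tree_path: "initial_run (tree_path t) = first_run t"
  using hd_runs[of "tree_path t"] hd_runs_tree_path[of t] by simp

lemma weight_eq: "weight t = (\<Prod>r\<leftarrow>runs (tree_path t). 1 / fact r)"
proof (induction t)
  case (Node l r)
  obtain rs where "runs (tree_path l) = first_run l # rs"
    using hd_runs_tree_path[of l] by (cases "runs (tree_path l)") auto
  then show ?case using Node by (simp add: runs_append_East)
qed simp

fun increasing_blocks :: "nat list \<Rightarrow> nat list \<Rightarrow> bool" where
  "increasing_blocks [] w \<longleftrightarrow> w = []"
| "increasing_blocks (r # rs) w \<longleftrightarrow>
     r \<le> length w \<and> sorted_wrt (<) (take r w) \<and> increasing_blocks rs (drop r w)"

lemma increasing_blocks_length: "increasing_blocks rs w \<Longrightarrow> length w = sum_list rs"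
proof (induction rs arbitrary: w)
  case (Cons r rs)
  then have "length (drop r w) = sum_list rs" "r \<le> length w"
    using Cons.IH[of "drop r w"] by auto
  then show ?case by simp
qed simp

lemma increasing_blocks_Cons_Suc:
  "increasing_blocks (Suc r # rs) (a # w) \<longleftrightarrow>
     (0 < r \<longrightarrow> a < hd w) \<and> increasing_blocks (r # rs) w"
  by (cases r; cases w) (auto dest: order.strict_trans)

lemma all_nat_cases: "(\<forall>k. R k) \<longleftrightarrow> R 0 \<and> (\<forall>k. R (Suc k))" for R :: "nat \<Rightarrow> bool"
  by (metis not0_implies_Suc)

lemma increasing_blocks_runs:
  assumes "length w = count_list Q North"
  shows "increasing_blocks (runs Q) w \<longleftrightarrow>
    (\<forall>k. Suc k < length Q \<and> Q ! k = North \<and> Q ! Suc k = North \<longrightarrow>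
        w ! count_list (take k Q) North < w ! count_list (take (Suc k) Q) North)"
  (is "_ \<longleftrightarrow> ?I Q w")
  using assms
proof (induction Q arbitrary: w rule: runs.induct)
  case 1
  then show ?case by simp
next
  case (2 P)
  have "?I (East # P) w \<longleftrightarrow> ?I P w"
    by (subst all_nat_cases) auto
  then show ?case using 2 by simp
next
  case (3 P)
  then obtain a w' where w: "w = a # w'" "length w' = count_list P North" by (cases w) auto
  have "?I (North # P) w \<longleftrightarrow> (0 < initial_run P \<longrightarrow> a < hd w') \<and> ?I P w'"
  proof -
    have "0 < initial_run P \<longleftrightarrow> P \<noteq> [] \<and> P ! 0 = North"
      by (cases P) (auto simp: initial_run_def)
    moreover have "hd w' = w' ! 0" if "P \<noteq> []" "P ! 0 = North"
      using that w by (cases P; cases w') auto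
    ultimately show ?thesis
      unfolding w by (subst all_nat_cases) auto
  qed
  also have "\<dots> \<longleftrightarrow> (0 < initial_run P \<longrightarrow> a < hd w') \<and> increasing_blocks (runs P) w'"
    using "3.IH"[OF w(2)] by simp
  also have "\<dots> \<longleftrightarrow> increasing_blocks (runs (North # P)) w"
    using increasing_blocks_Cons_Suc[of "hd (runs P)" "tl (runs P)" a w']
    by (simp only: runs.simps w(1) hd_runs[symmetric] list.collapse[OF runs_not_Nil])
  finally show ?case by (rule sym)
qed

text \<open>The multinomial coefficient, by recursion on the blocks: the first block is determined by its set
of entries, and the other blocks are filled with the remaining labels.\<close>

lemma card_increasing_blocks:
  assumes "finite S" and "card S = sum_list rs"
  shows "of_nat (card {w. distinct w \<and> set w = S \<and> increasing_blocks rs w})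
    = (fact (card S) * (\<Prod>r\<leftarrow>rs. 1 / fact r) :: rat)"
  using assms
proof (induction rs arbitrary: S)
  case Nil
  then have "{w. distinct w \<and> set w = S \<and> increasing_blocks [] w} = {[]}"
    using Nil by auto
  then show ?case using Nil by (simp del: increasing_blocks.simps)
next
  case (Cons r rs)
  define X where "X rs S = {w. distinct w \<and> set w = S \<and> increasing_blocks rs w}" for rs and S :: "nat set"
  define Ts where "Ts = {T. T \<subseteq> S \<and> card T = r}"
  let ?f = "\<lambda>(T, w). sorted_list_of_set T @ w" and ?g = "\<lambda>w. (set (take r w), drop r w)"
  have Ts: "finite T" "T \<subseteq> S" "card T = r" if "T \<in> Ts" for T
    using that Cons.prems(1) by (auto simp: Ts_def dest: finite_subset)
  have finX: "finite (X rs S)" if "finite S" for rs S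
    by (rule finite_subset[OF _ finite_lists_length_eq[OF that, of "card S"]])
      (auto simp: X_def distinct_card)
  have left_inverse: "?g (?f a) = a" if mem: "a \<in> (SIGMA T:Ts. X rs (S - T))" for a
  proof -
    obtain T w where a: "a = (T, w)" "T \<in> Ts" using mem by blast
    then show ?thesis using Ts[of T] by simp
  qed
  have right_inverse: "?f (?g w) = w" if "w \<in> X (r # rs) S" for w
  proof -
    from that have "sorted_wrt (<) (take r w)" by (auto simp: X_def)
    then have "sorted (take r w)" "distinct (take r w)"
      by (blast dest: strict_sorted_iff[THEN iffD1])+
    then have "sorted_list_of_set (set (take r w)) = take r w"
      by (rule sorted_list_of_set.idem_if_sorted_distinct)
    then show ?thesis by simp
  qed
  have f_mem: "?f a \<in> X (r # rs) S" if mem: "a \<in> (SIGMA T:Ts. X rs (S - T))" for a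
  proof -
    obtain T w where a: "a = (T, w)" "T \<in> Ts" "w \<in> X rs (S - T)" using mem by blast
    note T = Ts[OF a(2)]
    then have "set (sorted_list_of_set T @ w) = S" "distinct (sorted_list_of_set T @ w)"
      using a by (auto simp: X_def)
    then show ?thesis using a T by (simp add: X_def)
  qed
  have g_mem: "?g w \<in> (SIGMA T:Ts. X rs (S - T))" if "w \<in> X (r # rs) S" for w
  proof -
    have w: "distinct w" "set w = S" "r \<le> length w" "increasing_blocks rs (drop r w)"
      using that by (auto simp: X_def)
    have "set (take r w) \<union> set (drop r w) = S"
      using w(2) by (metis append_take_drop_id set_append)
    moreover have "set (take r w) \<inter> set (drop r w) = {}"
      using w(1) by (simp add: set_take_disj_set_drop_if_distinct)
    ultimately have "set (take r w) \<subseteq> S" "set (drop r w) = S - set (take r w)" by blast+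
    moreover have "card (set (take r w)) = r"
      using w by (simp add: distinct_card)
    ultimately show ?thesis using w by (simp add: X_def Ts_def)
  qed
  have "bij_betw ?f (SIGMA T:Ts. X rs (S - T)) (X (r # rs) S)"
    by (rule bij_betw_byWitness[where f' = ?g])
      (use left_inverse right_inverse f_mem g_mem in blast)+
  then have "card (X (r # rs) S) = card (SIGMA T:Ts. X rs (S - T))"
    by (rule bij_betw_same_card[symmetric])
  moreover have "finite Ts" unfolding Ts_def using Cons.prems(1) by simp
  then have "card (SIGMA T:Ts. X rs (S - T)) = (\<Sum>T\<in>Ts. card (X rs (S - T)))"
    using Cons.prems(1) finX by (simp add: card_SigmaI)
  moreover have "of_nat (card (X rs (S - T))) = (fact (sum_list rs) * (\<Prod>r\<leftarrow>rs. 1 / fact r) :: rat)"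
    if "T \<in> Ts" for T
  proof -
    have "card (S - T) = sum_list rs"
      using Ts[OF that] Cons.prems by (simp add: card_Diff_subset)
    then show ?thesis using Cons.IH[of "S - T"] Cons.prems unfolding X_def by simp
  qed
  moreover have "card Ts = (sum_list rs + r) choose r"
    unfolding Ts_def n_subsets[OF Cons.prems(1)] using Cons.prems(2) by (simp add: add.commute)
  ultimately have "of_nat (card (X (r # rs) S)) =
    (of_nat ((sum_list rs + r) choose r) * (fact (sum_list rs) * (\<Prod>r\<leftarrow>rs. 1 / fact r)) :: rat)"
    by simp
  also have "of_nat ((sum_list rs + r) choose r) = (fact (sum_list rs + r) / (fact r * fact (sum_list rs)) :: rat)"
    by (subst binomial_fact) auto
  finally show ?case using Cons.prems by (simp add: X_def add.commute)
qed

text \<open>A labelling is a filling of the runs of north steps by increasing blocks.\<close>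

lemma card_labelling:
  "of_nat (card {w. labelling (nodes q) (tree_path q) w}) = fact (nodes q) * weight q"
proof -
  have "{w. labelling (nodes q) (tree_path q) w}
     = {w. distinct w \<and> set w = {1..nodes q} \<and> increasing_blocks (runs (tree_path q)) w}"
    using increasing_blocks_runs[of _ "tree_path q"] increasing_blocks_length[of "runs (tree_path q)"]
    unfolding labelling_def sum_list_runs by auto
  then show ?thesis
    by (simp add: card_increasing_blocks sum_list_runs weight_eq)
qed

lemma finite_labelling: "finite {w. labelling n Q w}"
  by (rule finite_subset[OF _ finite_lists_length_eq[of "{1..n}" n]]) (auto simp: labelling_def)

section \<open>Labelled intervals counted by trees\<close>

definition intervals :: "nat \<Rightarrow> (btree \<times> btree) set" where
  "intervals n = {(p, q). p \<sqsubseteq> q \<and> nodes q = n}"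

lemma finite_nodes_le: "finite {t. nodes t \<le> n}"
proof (induction n)
  case 0
  have "{t. nodes t \<le> 0} \<subseteq> {Leaf}"
    by (auto elim: nodes.elims)
  then show ?case by (rule finite_subset) simp
next
  case (Suc n)
  have "{t. nodes t \<le> Suc n} \<subseteq> insert Leaf ((\<lambda>(l, r). Node l r) ` ({t. nodes t \<le> n} \<times> {t. nodes t \<le> n}))"
  proof
    fix t assume "t \<in> {t. nodes t \<le> Suc n}"
    then show "t \<in> insert Leaf ((\<lambda>(l, r). Node l r) ` ({t. nodes t \<le> n} \<times> {t. nodes t \<le> n}))"
      by (cases t) auto
  qed
  then show ?case by (rule finite_subset) (use Suc in simp)
qed

lemma finite_intervals [simp]: "finite (intervals n)"
  by (rule finite_subset[OF _ finite_cartesian_product[OF finite_nodes_le[of n] finite_nodes_le[of n]]])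
    (auto simp: intervals_def dest: tle_nodes)

lemma of_nat_mult_monom:
  "of_nat m * monom (monom (c :: rat) i) j = monom (monom (of_nat m * c) i) j"
  by (induction m) (simp_all add: algebra_simps add_monom)

text \<open>Labels are summed out: the labellings of an upper path contribute its weight once the factor
\<open>1 / n!\<close> is taken into account.\<close>

lemma tamari_gf_nth:
  "fps_nth tamari_gf n = (\<Sum>(p, q)\<in>intervals n. monom (monom (weight q) (touches p)) (first_run q))"
proof -
  define L where "L q = {w. labelling n (tree_path q) w}" for q
  have finL: "finite (L q)" for q unfolding L_def by (rule finite_labelling)
  let ?f = "\<lambda>((p, q), w). (tree_path p, tree_path q, w)"
  have eq: "labelled_intervals n = ?f ` (SIGMA pq:intervals n. L (snd pq))"
  proof (intro equalityI subsetI)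
    fix z assume "z \<in> labelled_intervals n"
    then obtain P Q w where z: "z = (P, Q, w)" "tamari_le n P Q" "labelling n Q w"
      by (auto simp: labelled_intervals_def)
    then obtain p q where "P = tree_path p" "Q = tree_path q" "p \<sqsubseteq> q" "nodes q = n"
      unfolding tamari_le_iff by blast
    then have "z = ?f ((p, q), w)" "((p, q), w) \<in> (SIGMA pq:intervals n. L (snd pq))"
      using z by (simp_all add: intervals_def L_def)
    then show "z \<in> ?f ` (SIGMA pq:intervals n. L (snd pq))" by (rule image_eqI)
  next
    fix z assume "z \<in> ?f ` (SIGMA pq:intervals n. L (snd pq))"
    then obtain p q w where "z = (tree_path p, tree_path q, w)" "(p, q) \<in> intervals n" "w \<in> L q"
      by auto
    then show "z \<in> labelled_intervals n"
      unfolding labelled_intervals_def tamari_le_iff intervals_def L_def by blast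
  qed
  have inj: "inj_on ?f (SIGMA pq:intervals n. L (snd pq))"
    by (auto simp: inj_on_def tree_path_inject)
  let ?G = "\<lambda>pq. monom (monom (1 / fact n :: rat) (touches (fst pq))) (first_run (snd pq))"
  have "fps_nth tamari_gf n = (\<Sum>z\<in>(SIGMA pq:intervals n. L (snd pq)).
      (\<lambda>(P, Q, w). monom (monom (1 / fact n) (contacts P)) (initial_run Q)) (?f z))"
    unfolding tamari_gf_def fps_nth_Abs_fps eq by (simp only: sum.reindex[OF inj] o_def)
  also have "\<dots> = (\<Sum>(pq, w)\<in>(SIGMA pq:intervals n. L (snd pq)). ?G pq)"
    by (intro sum.cong) (auto simp: contacts_tree_path initial_run_tree_path)
  also have "\<dots> = (\<Sum>pq\<in>intervals n. \<Sum>w\<in>L (snd pq). ?G pq)"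
    by (rule sum.Sigma[symmetric]) (simp_all add: finL)
  also have "\<dots> = (\<Sum>pq\<in>intervals n. monom (monom (weight (snd pq)) (touches (fst pq))) (first_run (snd pq)))"
  proof (rule sum.cong[OF refl])
    fix pq assume "pq \<in> intervals n"
    then have "nodes (snd pq) = n" by (auto simp: intervals_def)
    then have "of_nat (card (L (snd pq))) = fact n * weight (snd pq)"
      using card_labelling[of "snd pq"] by (simp add: L_def)
    then show "(\<Sum>w\<in>L (snd pq). monom (monom (1 / fact n) (touches (fst pq))) (first_run (snd pq)))
      = monom (monom (weight (snd pq)) (touches (fst pq))) (first_run (snd pq))"
      by (simp add: of_nat_mult_monom)
  qed
  finally show ?thesis by (simp add: case_prod_beta)
qed

section \<open>The recursion for intervals\<close>

text \<open>The ways to cut a ballot path at one of its contacts, listed from left to right; see \<open>set_splits\<close>.\<close>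

fun splits :: "btree \<Rightarrow> (btree \<times> btree) list" where
  "splits Leaf = [(Leaf, Leaf)]"
| "splits (Node l r) = (Leaf, Node l r) # map (\<lambda>(a, b). (Node l a, b)) (splits r)"

lemma set_splits: "set (splits t) = {(a, b). graft a b = t}"
proof (induction t)
  case Leaf
  have "graft a b = Leaf \<longleftrightarrow> a = Leaf \<and> b = Leaf" for a b by (cases a) auto
  then show ?case by auto
next
  case (Node l r)
  have "graft a b = Node l r \<longleftrightarrow> (a = Leaf \<and> b = Node l r) \<or> (\<exists>a'. a = Node l a' \<and> graft a' b = r)"
    for a b by (cases a) auto
  then show ?case using Node by (auto simp: image_iff)
qed

lemma finite_splits: "finite {(a, b). graft a b = t}"
  unfolding set_splits[symmetric] by simp

text \<open>Cutting at the contacts from right to left, the right-hand part has \<open>1, 2, ..., touches t\<close>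
contacts, so the sum is geometric.\<close>

lemma sum_splits:
  fixes x :: "'a :: comm_ring_1"
  shows "(x - 1) * (\<Sum>(a, b) | graft a b = t. x ^ touches b) = x * (x ^ touches t - 1)"
proof (induction t)
  case Leaf
  then show ?case by (simp add: set_splits[symmetric] algebra_simps)
next
  case (Node l r)
  have "{(a, b). graft a b = Node l r} = insert (Leaf, Node l r) ((\<lambda>(a, b). (Node l a, b)) ` {(a, b). graft a b = r})"
    unfolding set_splits[symmetric] by simp
  moreover have "inj_on (\<lambda>(a, b). (Node l a, b)) {(a, b). graft a b = r}"
    by (auto simp: inj_on_def)
  moreover have "(Leaf, Node l r) \<notin> (\<lambda>(a, b). (Node l a, b)) ` {(a, b). graft a b = r}"
    by auto
  ultimately have "(\<Sum>(a, b) | graft a b = Node l r. x ^ touches b)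
     = x ^ Suc (touches r) + (\<Sum>(a, b) | graft a b = r. x ^ touches b)"
    by (simp add: finite_splits sum.reindex) (simp add: case_prod_beta)
  then show ?case using Node.IH(2) by (simp add: algebra_simps)
qed

lemma touches_graft: "touches (graft a b) + 1 = touches a + touches b"
  by (induction a) auto

lemma graft_cancel: "nodes b = nodes b' \<Longrightarrow> graft a b = graft a' b' \<longleftrightarrow> a = a' \<and> b = b'"
proof -
  assume "nodes b = nodes b'"
  then have "length (tree_path b) = length (tree_path b')" by simp
  then have "tree_path a @ tree_path b = tree_path a' @ tree_path b' \<longleftrightarrow> tree_path a = tree_path a' \<and> tree_path b = tree_path b'"
    by simp
  then show ?thesis by (metis tree_path_inject tree_path_graft)
qed

text \<open>The bijection of \<open>tle_Node_iff\<close> as an identity between sums. An interval with upper path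
\<open>N q1 E q2\<close> is encoded by the intervals \<open>(p1, q1)\<close> and \<open>(c, q2)\<close> and a cut of \<open>p1\<close> into
\<open>a\<close> and \<open>b\<close>; its lower path \<open>N a E b c\<close> has \<open>touches b + touches c\<close> contacts. The sum
over the cuts is evaluated by \<open>sum_splits\<close>. The weight \<open>h\<close> may depend on the upper path in
any way.\<close>

lemma sum_intervals_Suc:
  fixes x :: "'a :: comm_ring_1" and h :: "btree \<Rightarrow> 'a"
  shows "(x - 1) * (\<Sum>(p, q)\<in>intervals (Suc n). h q * x ^ touches p) =
    x * (\<Sum>k\<le>n. \<Sum>(p1, q1)\<in>intervals k. \<Sum>(p2, q2)\<in>intervals (n - k).
       h (Node q1 q2) * (x ^ touches p1 - 1) * x ^ touches p2)"
proof -
  define S where "S p = {(a, b). graft a b = p}" for p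
  define F where "F k i j s = h (Node (snd i) (snd j)) * x ^ touches (fst j) * x ^ touches (snd s)"
    for k :: nat and i j s :: "btree \<times> btree"
  have finS: "finite (S p)" for p unfolding S_def by (rule finite_splits)
  define K where "K = (SIGMA k:{..n}. SIGMA i:intervals k. intervals (n - k) \<times> S (fst i))"
  let ?f = "\<lambda>(k::nat, (p1::btree, q1), (c, q2), (a, b)). (Node a (graft b c), Node q1 q2)"
  have K: "(k, (p1, q1), (c, q2), (a, b)) \<in> K \<longleftrightarrow>
     k = nodes q1 \<and> n = k + nodes q2 \<and> p1 \<sqsubseteq> q1 \<and> c \<sqsubseteq> q2 \<and> p1 = graft a b"
    for k p1 q1 c q2 a b
    by (auto simp: K_def S_def intervals_def)
  have "bij_betw ?f K (intervals (Suc n))"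
    unfolding bij_betw_def
  proof
    show "inj_on ?f K"
    proof (rule inj_onI)
      fix s s' assume s: "s \<in> K" "s' \<in> K" and eq: "?f s = ?f s'"
      obtain k p1 q1 c q2 a b where s1: "s = (k, (p1, q1), (c, q2), (a, b))" by (metis prod.exhaust)
      obtain k' p1' q1' c' q2' a' b' where s2: "s' = (k', (p1', q1'), (c', q2'), (a', b'))" by (metis prod.exhaust)
      have q: "q1 = q1'" "q2 = q2'" "a = a'" "graft b c = graft b' c'" using eq s1 s2 by auto
      have k: "c \<sqsubseteq> q2" "k = nodes q1" "p1 = graft a b" "c' \<sqsubseteq> q2'" "k' = nodes q1'" "p1' = graft a' b'"
        using s unfolding s1 s2 K by blast+
      \<comment> \<open>The size of \<open>q2\<close> tells where \<open>b\<close> ends and \<open>c\<close> begins.\<close>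
      have "nodes c = nodes c'" using tle_nodes[OF k(1)] tle_nodes[OF k(4)] q(2) by simp
      then have "b = b'" "c = c'" using q(4) graft_cancel by blast+
      then show "s = s'" using k q(1-3) unfolding s1 s2 by simp
    qed
    show "?f ` K = intervals (Suc n)"
    proof (intro equalityI subsetI)
      fix s assume "s \<in> ?f ` K"
      then obtain k p1 q1 c q2 a b where "s = ?f (k, (p1, q1), (c, q2), (a, b))"
        "(k, (p1, q1), (c, q2), (a, b)) \<in> K" by (rule imageE) (metis prod.exhaust)
      then have "s = (Node a (graft b c), Node q1 q2)" "nodes (Node q1 q2) = Suc n"
        "graft a b \<sqsubseteq> q1" "c \<sqsubseteq> q2"
        unfolding K by auto
      then show "s \<in> intervals (Suc n)"
        unfolding intervals_def using tle_Node_iff by blast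
    next
      fix s assume s: "s \<in> intervals (Suc n)"
      obtain p q where pq: "s = (p, q)" by force
      then obtain q1 q2 where q: "q = Node q1 q2" using s by (cases q) (auto simp: intervals_def)
      then obtain a b c where "p = Node a (graft b c)" "graft a b \<sqsubseteq> q1" "c \<sqsubseteq> q2"
        using s pq tle_Node_iff unfolding intervals_def by blast
      then have "s = ?f (nodes q1, (graft a b, q1), (c, q2), (a, b))"
         "(nodes q1, (graft a b, q1), (c, q2), (a, b)) \<in> K"
        using s pq q unfolding K by (auto simp: intervals_def)
      then show "s \<in> ?f ` K" by (rule image_eqI)
    qed
  qed
  then have "(\<Sum>(p, q)\<in>intervals (Suc n). h q * x ^ touches p) =
    (\<Sum>s\<in>K. (\<lambda>(p, q). h q * x ^ touches p) (?f s))"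
    by (rule sum.reindex_bij_betw[symmetric])
  also have "\<dots> = (\<Sum>(k, (p1, q1), (c, q2), (a, b))\<in>K. h (Node q1 q2) * x ^ touches c * x ^ touches b)"
  proof (rule sum.cong[OF refl])
    fix s assume "s \<in> K"
    obtain k p1 q1 c q2 a b where s: "s = (k, (p1, q1), (c, q2), (a, b))" by (metis prod.exhaust)
    have "Suc (touches (graft b c)) = touches c + touches b" using touches_graft[of b c] by simp
    then show "(\<lambda>(p, q). h q * x ^ touches p) (?f s) =
      (\<lambda>(k, (p1, q1), (c, q2), (a, b)). h (Node q1 q2) * x ^ touches c * x ^ touches b) s"
      unfolding s by (simp add: mult.assoc flip: power_add power_Suc)
  qed
  also have "\<dots> = (\<Sum>(k, i, j, s)\<in>K. F k i j s)"
    by (simp add: F_def case_prod_beta)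
  also have "\<dots> = (\<Sum>k\<le>n. \<Sum>i\<in>intervals k. \<Sum>j\<in>intervals (n - k). \<Sum>s\<in>S (fst i). F k i j s)"
    unfolding K_def by (simp add: sum.Sigma finS)
  finally have "(\<Sum>(p, q)\<in>intervals (Suc n). h q * x ^ touches p) = \<dots>" .
  moreover have "(x - 1) * (\<Sum>s\<in>S (fst i). F k i j s)
      = x * (h (Node (snd i) (snd j)) * (x ^ touches (fst i) - 1) * x ^ touches (fst j))" for k i j
  proof -
    have "(x - 1) * (\<Sum>s\<in>S (fst i). F k i j s) = h (Node (snd i) (snd j)) * x ^ touches (fst j)
        * ((x - 1) * (\<Sum>(a, b)\<in>S (fst i). x ^ touches b))"
      by (simp add: F_def sum_distrib_left case_prod_beta mult.left_commute)
    then show ?thesis unfolding S_def sum_splits by (simp add: algebra_simps)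
  qed
  ultimately show ?thesis
    by (simp add: sum_distrib_left case_prod_beta)
qed

section \<open>Coefficientwise operations on power series over Laurent polynomials\<close>

abbreviation lmono :: "int \<Rightarrow> rat poly \<Rightarrow> laurent" where "lmono \<equiv> Poly_Mapping.single"

lemma laurent_eq_sum: "p = (\<Sum>i\<in>Poly_Mapping.keys p. lmono i (Poly_Mapping.lookup p i))"
  by (rule poly_mapping_eqI)
    (auto simp: lookup_sum lookup_single when_def not_in_keys_iff_lookup_eq_zero)

lemma laurent_induct [case_names single add]:
  assumes "\<And>i c. P (lmono i c)" and "\<And>p q. P p \<Longrightarrow> P q \<Longrightarrow> P (p + q)"
  shows "P (p :: laurent)"
proof -
  have zero: "P 0" using assms(1)[of 0 0] by simp
  have "P (\<Sum>i\<in>I. lmono i (Poly_Mapping.lookup p i))" if "finite I" for I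
    using that
  proof (induction I rule: finite_induct)
    case (insert i I)
    then show ?case using assms by simp
  qed (simp add: zero)
  then show ?thesis by (subst laurent_eq_sum) simp
qed

lemma lookup_lmono_mult: "Poly_Mapping.lookup (lmono i a * q) k = a * Poly_Mapping.lookup q (k - i)"
  by (induction q rule: laurent_induct)
    (auto simp: mult_single lookup_single when_def lookup_add algebra_simps)

lemma lookup_map: "f 0 = 0 \<Longrightarrow> Poly_Mapping.lookup (Poly_Mapping.map f p) k = f (Poly_Mapping.lookup p k)"
  by transfer (simp add: when_def)

lemma lookup_nonneg_part:
  "Poly_Mapping.lookup (nonneg_part p) k = (if 0 \<le> k then Poly_Mapping.lookup p k else 0)"
  unfolding nonneg_part_def
  by (auto simp: lookup_sum lookup_single when_def not_in_keys_iff_lookup_eq_zero)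

definition pderiv_y :: "laurent \<Rightarrow> laurent" where
  "pderiv_y = Poly_Mapping.map pderiv"

definition subst_y :: "rat \<Rightarrow> laurent \<Rightarrow> laurent" where
  "subst_y a = Poly_Mapping.map (\<lambda>c. [:poly c a:])"

text \<open>On polynomials in \<open>u\<close> this is the evaluation at \<open>u = 0\<close>, with value in the constants; it is
additive everywhere, but multiplicative only on polynomials (\<open>coeff_u0_mult\<close>).\<close>

definition coeff_u0 :: "laurent \<Rightarrow> laurent" where
  "coeff_u0 p = lmono 0 (Poly_Mapping.lookup p 0)"

lemma lookup_pderiv_y: "Poly_Mapping.lookup (pderiv_y p) k = pderiv (Poly_Mapping.lookup p k)"
  by (simp add: pderiv_y_def lookup_map)

lemma lookup_subst_y: "Poly_Mapping.lookup (subst_y a p) k = [:poly (Poly_Mapping.lookup p k) a:]"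
  by (simp add: subst_y_def lookup_map)

lemma pderiv_y_add: "pderiv_y (p + q) = pderiv_y p + pderiv_y q"
  by (rule poly_mapping_eqI) (simp add: lookup_pderiv_y lookup_add pderiv_add)

lemma pderiv_y_single [simp]: "pderiv_y (lmono i c) = lmono i (pderiv c)"
  by (rule poly_mapping_eqI) (simp add: lookup_pderiv_y lookup_single when_def)

lemma pderiv_y_mult: "pderiv_y (p * q) = pderiv_y p * q + p * pderiv_y q"
proof (induction p rule: laurent_induct)
  case (single i c)
  show ?case
    by (induction q rule: laurent_induct)
      (simp_all add: mult_single pderiv_mult single_add pderiv_y_add algebra_simps)
qed (simp add: pderiv_y_add algebra_simps)

lemma subst_y_add: "subst_y a (p + q) = subst_y a p + subst_y a q"
  by (rule poly_mapping_eqI) (simp add: lookup_subst_y lookup_add)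

lemma subst_y_single [simp]: "subst_y a (lmono i c) = lmono i [:poly c a:]"
  by (rule poly_mapping_eqI) (simp add: lookup_subst_y lookup_single when_def)

lemma subst_y_mult: "subst_y a (p * q) = subst_y a p * subst_y a q"
proof (induction p rule: laurent_induct)
  case (single i c)
  show ?case
    by (induction q rule: laurent_induct)
      (simp_all add: mult_single subst_y_add algebra_simps)
qed (simp add: subst_y_add algebra_simps)

lemma coeff_u0_add: "coeff_u0 (p + q) = coeff_u0 p + coeff_u0 q"
  by (simp add: coeff_u0_def lookup_add single_add)

lemma polynomial_in_u_iff: "polynomial_in_u p \<longleftrightarrow> (\<forall>k<0. Poly_Mapping.lookup p k = 0)"
  unfolding polynomial_in_u_def by (force simp: in_keys_iff not_le)

lemma polynomial_in_u_mult:
  assumes "polynomial_in_u p" "polynomial_in_u q" shows "polynomial_in_u (p * q)"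
proof -
  have "i + j \<ge> 0" if "i \<in> Poly_Mapping.keys p" "j \<in> Poly_Mapping.keys q" for i j
    using that assms by (auto simp: polynomial_in_u_def)
  then show ?thesis using keys_mult[of p q] unfolding polynomial_in_u_def by fastforce
qed

lemma coeff_u0_mult:
  assumes "polynomial_in_u p" "polynomial_in_u q"
  shows "coeff_u0 (p * q) = coeff_u0 p * coeff_u0 q"
proof -
  have "Poly_Mapping.lookup (p * q) 0 = (\<Sum>i\<in>Poly_Mapping.keys p.
      Poly_Mapping.lookup p i * Poly_Mapping.lookup q (- i))"
    by (subst laurent_eq_sum[of p]) (simp add: sum_distrib_right lookup_sum lookup_lmono_mult)
  also have "\<dots> = (\<Sum>i\<in>Poly_Mapping.keys p. if i = 0 then Poly_Mapping.lookup p 0 * Poly_Mapping.lookup q 0 else 0)"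
  proof (intro sum.cong refl)
    fix i assume "i \<in> Poly_Mapping.keys p"
    then have "0 \<le> i" using assms(1) by (simp add: polynomial_in_u_def)
    then show "Poly_Mapping.lookup p i * Poly_Mapping.lookup q (- i) =
        (if i = 0 then Poly_Mapping.lookup p 0 * Poly_Mapping.lookup q 0 else 0)"
      using assms(2) by (simp add: polynomial_in_u_iff)
  qed
  also have "\<dots> = Poly_Mapping.lookup p 0 * Poly_Mapping.lookup q 0"
    by (auto simp: not_in_keys_iff_lookup_eq_zero)
  finally show ?thesis by (simp add: coeff_u0_def mult_single)
qed

text \<open>In characteristic zero a polynomial in \<open>y\<close> is determined by its derivative and its constant
term.\<close>

lemma laurent_eqI_pderiv_y:
  assumes "pderiv_y p = pderiv_y q" "subst_y 0 p = subst_y 0 q"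
  shows "p = q"
proof (rule poly_mapping_eqI)
  fix k
  let ?a = "Poly_Mapping.lookup p k" and ?b = "Poly_Mapping.lookup q k"
  have "pderiv ?a = pderiv ?b" using assms(1) by (metis lookup_pderiv_y)
  then have "pderiv (?a - ?b) = 0" by (simp add: pderiv_diff)
  then have "degree (?a - ?b) = 0" by (simp add: pderiv_eq_0_iff)
  then obtain c where c: "?a - ?b = [:c:]" by (rule degree_eq_zeroE)
  have "poly ?a 0 = poly ?b 0" using assms(2) lookup_subst_y[of 0 p k] lookup_subst_y[of 0 q k] by simp
  then have "poly (?a - ?b) 0 = 0" by simp
  then show "?a = ?b" using c by simp
qed

definition coeffwise :: "(laurent \<Rightarrow> laurent) \<Rightarrow> laurent fps \<Rightarrow> laurent fps" where
  "coeffwise D G = Abs_fps (\<lambda>n. D (fps_nth G n))"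

lemma coeffwise_nth [simp]: "fps_nth (coeffwise D G) n = D (fps_nth G n)"
  by (simp add: coeffwise_def)

lemma additive_0: "(\<And>p q. D (p + q) = D p + D q) \<Longrightarrow> D (0 :: 'a :: ab_group_add) = (0 :: 'b :: ab_group_add)"
  by (metis add_cancel_right_left)

lemma additive_sum:
  assumes "\<And>p q. D (p + q) = D p + (D q :: 'b :: ab_group_add)"
  shows "D (\<Sum>i\<in>I. f i :: 'a :: ab_group_add) = (\<Sum>i\<in>I. D (f i))"
  using additive_0[of D, OF assms] by (induction I rule: infinite_finite_induct) (simp_all add: assms)

abbreviation dy :: "laurent fps \<Rightarrow> laurent fps" where "dy \<equiv> coeffwise pderiv_y"
abbreviation at_y :: "rat \<Rightarrow> laurent fps \<Rightarrow> laurent fps" where "at_y a \<equiv> coeffwise (subst_y a)"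
abbreviation at_u0 :: "laurent fps \<Rightarrow> laurent fps" where "at_u0 \<equiv> coeffwise coeff_u0"
abbreviation (input) poly_u :: "laurent fps \<Rightarrow> bool" where "poly_u G \<equiv> (\<forall>n. polynomial_in_u (fps_nth G n))"

lemma coeffwise_add:
  "(\<And>p q. D (p + q) = D p + D q) \<Longrightarrow> coeffwise D (F + G) = coeffwise D F + coeffwise D G"
  by (rule fps_ext) simp

lemma coeffwise_sum:
  "(\<And>p q. D (p + q) = D p + D q) \<Longrightarrow> coeffwise D (\<Sum>i\<in>I. f i) = (\<Sum>i\<in>I. coeffwise D (f i))"
  by (rule fps_ext) (simp add: fps_sum_nth additive_sum)

lemmas dy_add = coeffwise_add[of pderiv_y, OF pderiv_y_add]
lemmas dy_sum = coeffwise_sum[of pderiv_y, OF pderiv_y_add]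
lemmas at_y_add = coeffwise_add[of "subst_y a" for a, OF subst_y_add]
lemmas at_y_sum = coeffwise_sum[of "subst_y a" for a, OF subst_y_add]
lemmas at_u0_add = coeffwise_add[of coeff_u0, OF coeff_u0_add]
lemmas at_u0_sum = coeffwise_sum[of coeff_u0, OF coeff_u0_add]

lemma dy_mult: "dy (F * G) = dy F * G + F * dy G"
  by (rule fps_ext)
    (simp add: fps_mult_nth additive_sum[of pderiv_y, OF pderiv_y_add] pderiv_y_mult sum.distrib)

lemma at_y_mult: "at_y a (F * G) = at_y a F * at_y a G"
  by (rule fps_ext)
    (simp add: fps_mult_nth additive_sum[of "subst_y a", OF subst_y_add] subst_y_mult)

lemma at_u0_mult: "poly_u F \<Longrightarrow> poly_u G \<Longrightarrow> at_u0 (F * G) = at_u0 F * at_u0 G"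
  by (rule fps_ext)
    (simp add: fps_mult_nth additive_sum[of coeff_u0, OF coeff_u0_add] coeff_u0_mult)

lemma polynomial_in_u_0 [simp]: "polynomial_in_u 0"
  by (simp add: polynomial_in_u_iff)

lemma polynomial_in_u_add: "polynomial_in_u p \<Longrightarrow> polynomial_in_u q \<Longrightarrow> polynomial_in_u (p + q)"
  by (simp add: polynomial_in_u_iff lookup_add)

lemma polynomial_in_u_sum: "(\<And>i. i \<in> I \<Longrightarrow> polynomial_in_u (f i)) \<Longrightarrow> polynomial_in_u (sum f I)"
  by (simp add: polynomial_in_u_iff lookup_sum)

lemma polynomial_in_u_single: "0 \<le> i \<Longrightarrow> polynomial_in_u (lmono i c)"
  by (simp add: polynomial_in_u_iff lookup_single)

lemma poly_u_add: "poly_u F \<Longrightarrow> poly_u G \<Longrightarrow> poly_u (F + G)"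
  by (simp add: polynomial_in_u_add)

lemma poly_u_mult: "poly_u F \<Longrightarrow> poly_u G \<Longrightarrow> poly_u (F * G)"
  by (simp add: fps_mult_nth polynomial_in_u_sum polynomial_in_u_mult)

lemma poly_u_const: "polynomial_in_u c \<Longrightarrow> poly_u (fps_const c)"
  by (simp add: fps_const_def)

lemma poly_u_1: "poly_u 1"
  using polynomial_in_u_single[of 0 1] by simp

lemma poly_u_power: "poly_u F \<Longrightarrow> poly_u (F ^ n)"
  proof (induction n)
  case 0
  show ?case using poly_u_1 by simp
next
  case (Suc n)
  then show ?case using poly_u_mult[of F "F ^ n"] by simp
qed

lemma coeffwise_const: "D 0 = 0 \<Longrightarrow> coeffwise D (fps_const c) = fps_const (D c)"
  by (rule fps_ext) simp

lemma coefficient_maps_0 [simp]: "pderiv_y 0 = 0" "subst_y a 0 = 0" "coeff_u0 0 = 0"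
  by (simp_all add: additive_0 pderiv_y_add subst_y_add coeff_u0_add)

lemma coeff_u0_single: "coeff_u0 (lmono i c) = (if i = 0 then lmono 0 c else 0)"
  by (simp add: coeff_u0_def lookup_single)

lemma coefficient_maps_1 [simp]: "pderiv_y 1 = 0" "subst_y a 1 = 1" "coeff_u0 1 = 1"
  using pderiv_y_single[of 0 1] subst_y_single[of a 0 1] coeff_u0_single[of 0 1]
  by (simp_all add: pderiv_1 flip: one_pCons)

lemma coeffwise_1 [simp]: "dy 1 = 0" "at_y a 1 = 1" "at_u0 1 = 1"
  by (rule fps_ext, simp add: fps_one_nth)+

lemma at_y_power: "at_y a (F ^ n) = at_y a F ^ n"
  by (induction n) (simp_all add: at_y_mult)

lemma at_u0_power: "poly_u F \<Longrightarrow> at_u0 (F ^ n) = at_u0 F ^ n"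
proof (induction n)
  case (Suc n)
  then show ?case using at_u0_mult[of F "F ^ n"] poly_u_power[of F n] by simp
qed simp

lemma dy_power: "dy (F ^ n) = of_nat n * F ^ (n - 1) * dy F"
proof (induction n)
  case (Suc n)
  then show ?case by (cases n) (simp_all add: dy_mult algebra_simps)
qed simp

section \<open>Exponential series\<close>

text \<open>The series \<open>e^(zg)\<close> for a Laurent polynomial \<open>g\<close>; all exponentials of the theorem have this form.\<close>

definition expz :: "laurent \<Rightarrow> laurent fps" where
  "expz g = Abs_fps (\<lambda>n. rat_laurent (1 / fact n) * g ^ n)"

lemma exp_fps_zv: "exp_fps (zv * fps_const g) = expz g"
proof (rule fps_ext)
  fix n
  have "(zv * fps_const g) ^ i = fps_const (g ^ i) * fps_X ^ i" for i
    by (simp add: zv_def power_mult_distrib fps_const_power mult.commute)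
  then have "fps_nth (exp_fps (zv * fps_const g)) n =
      (\<Sum>i=0..n. rat_laurent (1 / fact i) * (if n = i then g ^ i else 0))"
    by (auto simp: exp_fps_def fps_compose_nth intro!: sum.cong)
  then show "fps_nth (exp_fps (zv * fps_const g)) n = fps_nth (expz g) n"
    by (simp add: expz_def if_distrib[of "\<lambda>c. _ * c"] cong: if_cong)
qed

lemma rat_laurent_mult: "rat_laurent (a * b) = rat_laurent a * rat_laurent b"
  by (simp add: rat_laurent_def mult_single mult.commute)

lemma rat_laurent_of_nat: "rat_laurent (of_nat n) = of_nat n"
  by (simp add: rat_laurent_def of_nat_poly[symmetric])

lemma rat_laurent_1 [simp]: "rat_laurent 1 = 1"
  using rat_laurent_of_nat[of 1] by simp

text \<open>The binomial theorem, coefficient by coefficient.\<close>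

lemma expz_add: "expz (g + h) = expz g * expz h"
proof (rule fps_ext)
  fix n
  have eq: "rat_laurent (1 / fact n) * (of_nat (n choose k) * g ^ k * h ^ (n - k)) =
    rat_laurent (1 / fact k) * g ^ k * (rat_laurent (1 / fact (n - k)) * h ^ (n - k))" if "k \<le> n" for k
  proof -
    have "1 / fact n * of_nat (n choose k) = (1 / fact k * (1 / fact (n - k)) :: rat)"
      using that by (simp add: binomial_fact field_simps)
    then have "rat_laurent (1 / fact n) * of_nat (n choose k) = rat_laurent (1 / fact k) * rat_laurent (1 / fact (n - k))"
      by (metis rat_laurent_mult rat_laurent_of_nat)
    then have "(rat_laurent (1 / fact n) * of_nat (n choose k)) * (g ^ k * h ^ (n - k)) =
        (rat_laurent (1 / fact k) * rat_laurent (1 / fact (n - k))) * (g ^ k * h ^ (n - k))"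
      by (rule arg_cong)
    then show ?thesis by (simp only: mult_ac)
  qed
  have "fps_nth (expz (g + h)) n =
      (\<Sum>k\<le>n. rat_laurent (1 / fact n) * (of_nat (n choose k) * g ^ k * h ^ (n - k)))"
    by (simp add: expz_def binomial_ring sum_distrib_left)
  also have "\<dots> = (\<Sum>k\<le>n. rat_laurent (1 / fact k) * g ^ k * (rat_laurent (1 / fact (n - k)) * h ^ (n - k)))"
    by (rule sum.cong[OF refl], rule eq) simp
  finally show "fps_nth (expz (g + h)) n = fps_nth (expz g * expz h) n"
    by (simp add: expz_def fps_mult_nth atLeast0AtMost)
qed

lemma expz_0 [simp]: "expz 0 = 1"
  by (rule fps_ext) (simp add: expz_def power_0_left)

lemma pderiv_y_power: "pderiv_y (g ^ n) = of_nat n * g ^ (n - 1) * pderiv_y g"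
proof (induction n)
  case 0
  then show ?case using pderiv_y_single[of 0 1] by (simp add: pderiv_1)
next
  case (Suc n)
  then show ?case by (cases n) (simp_all add: pderiv_y_mult algebra_simps)
qed

lemma pderiv_y_rat [simp]: "pderiv_y (rat_laurent q) = 0"
  by (simp add: rat_laurent_def pderiv_pCons)

lemma subst_y_rat [simp]: "subst_y a (rat_laurent q) = rat_laurent q"
  by (simp add: rat_laurent_def)

lemma subst_y_power: "subst_y a (g ^ n) = subst_y a g ^ n"
proof (induction n)
  case 0
  then show ?case by simp
qed (simp_all add: subst_y_mult)

lemma dy_expz: "dy (expz g) = zv * fps_const (pderiv_y g) * expz g"
proof (rule fps_ext)
  fix n
  show "fps_nth (dy (expz g)) n = fps_nth (zv * fps_const (pderiv_y g) * expz g) n"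
  proof (cases n)
    case 0
    then show ?thesis using pderiv_y_power[of g 0] by (simp add: expz_def zv_def pderiv_y_mult)
  next
    case (Suc m)
    have "1 / fact (Suc m) * of_nat (Suc m) = (1 / fact m :: rat)"
      by (simp add: fact_Suc del: of_nat_Suc)
    then have "rat_laurent (1 / fact (Suc m)) * of_nat (Suc m) = rat_laurent (1 / fact m)"
      by (metis rat_laurent_mult rat_laurent_of_nat)
    then have "rat_laurent (1 / fact (Suc m)) * (of_nat (Suc m) * g ^ m * pderiv_y g)
       = rat_laurent (1 / fact m) * g ^ m * pderiv_y g" by (simp only: mult.assoc[symmetric])
    moreover have "fps_nth (dy (expz g)) n
       = rat_laurent (1 / fact (Suc m)) * (of_nat (Suc m) * g ^ m * pderiv_y g)"
      unfolding Suc expz_def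
      by (simp only: coeffwise_nth fps_nth_Abs_fps pderiv_y_mult pderiv_y_rat pderiv_y_power) simp
    moreover have "fps_nth (zv * fps_const (pderiv_y g) * expz g) n
       = rat_laurent (1 / fact m) * g ^ m * pderiv_y g"
      unfolding Suc by (simp add: zv_def expz_def mult_ac)
    ultimately show ?thesis by simp
  qed
qed

lemma at_y_expz: "at_y a (expz g) = expz (subst_y a g)"
  by (rule fps_ext) (simp add: expz_def subst_y_mult subst_y_power)

lemma polynomial_in_u_power: "polynomial_in_u g \<Longrightarrow> polynomial_in_u (g ^ n)"
proof (induction n)
  case 0
  then show ?case using polynomial_in_u_single[of 0 1] by simp
qed (simp add: polynomial_in_u_mult)

lemma coeff_u0_power: "polynomial_in_u g \<Longrightarrow> coeff_u0 (g ^ n) = coeff_u0 g ^ n"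
proof (induction n)
  case 0
  then show ?case using coeff_u0_single[of 0 1] by simp
qed (simp add: polynomial_in_u_power coeff_u0_mult)

lemma polynomial_in_u_rat [simp]: "polynomial_in_u (rat_laurent q)"
  by (simp add: rat_laurent_def polynomial_in_u_single)

lemma poly_u_expz: "polynomial_in_u g \<Longrightarrow> poly_u (expz g)"
  by (simp add: expz_def polynomial_in_u_mult polynomial_in_u_power)

lemma at_u0_expz: "polynomial_in_u g \<Longrightarrow> at_u0 (expz g) = expz (coeff_u0 g)"
  by (rule fps_ext)
    (simp add: expz_def coeff_u0_mult polynomial_in_u_power coeff_u0_power rat_laurent_def
      coeff_u0_single polynomial_in_u_single)

section \<open>The explicit solution\<close>

text \<open>The coefficient \<open>y^i (y - 1)^j / (i! j!)\<close> of the double series.\<close>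

definition kernel_coeff :: "nat \<Rightarrow> nat \<Rightarrow> rat poly" where
  "kernel_coeff i j = smult (1 / (fact i * fact j)) ([:0, 1:] ^ i * [:-1, 1:] ^ j)"

text \<open>The Laurent series \<open>exp (zu(y - 1) + zy/u) - (1/u) exp (z(y - 1)/u + zyu)\<close>, whose non-negative
part is \<open>kernel_pos\<close>.\<close>

definition kernel :: "laurent fps" where
  "kernel = expz (lmono (-1) [:0, 1:] + lmono 1 [:-1, 1:])
    - ubar * expz (lmono 1 [:0, 1:] + lmono (-1) [:-1, 1:])"

definition kernel_pos :: "laurent fps" where
  "kernel_pos = nonneg_part_fps kernel"

lemma uv_ubar: "uv * ubar = 1"
  by (simp add: uv_def ubar_def mult_single)

lemma yv_minus_1: "yv - 1 = fps_const (lmono 0 [:-1, 1:])"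
proof -
  have "yv - 1 = fps_const (lmono 0 [:0, 1:] - lmono 0 1)"
    by (simp add: yv_def flip: fps_const_sub)
  then show ?thesis by (simp add: one_pCons flip: single_diff del: single_one)
qed

lemma kernel_eq:
  "exp_fps (zv * uv * (yv - 1) + zv * yv * ubar) - ubar * exp_fps (zv * ubar * (yv - 1) + zv * yv * uv) = kernel"
proof -
  have "zv * uv * (yv - 1) + zv * yv * ubar = zv * fps_const (lmono (-1) [:0, 1:] + lmono 1 [:-1, 1:])"
    unfolding yv_minus_1
    by (simp add: uv_def yv_def ubar_def mult_single mult.assoc distrib_left add.commute flip: fps_const_add)
  moreover have "zv * ubar * (yv - 1) + zv * yv * uv = zv * fps_const (lmono 1 [:0, 1:] + lmono (-1) [:-1, 1:])"
    unfolding yv_minus_1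
    by (simp add: uv_def yv_def ubar_def mult_single mult.assoc distrib_left add.commute flip: fps_const_add)
  ultimately show ?thesis by (simp add: exp_fps_zv kernel_def)
qed

lemma lmono_power: "lmono a p ^ n = lmono (a * int n) (p ^ n)"
  by (induction n) (simp_all add: mult_single algebra_simps)

lemma expz_lmono_nth: "fps_nth (expz (lmono a p)) n = lmono (a * int n) (smult (1 / fact n) (p ^ n))"
  by (simp add: expz_def lmono_power rat_laurent_def mult_single)

lemma expz_binomial_nth:
  "fps_nth (expz (lmono a p + lmono b q)) n =
    (\<Sum>i\<le>n. lmono (a * int i + b * int (n - i)) (smult (1 / (fact i * fact (n - i))) (p ^ i * q ^ (n - i))))"
  by (simp add: expz_add fps_mult_nth expz_lmono_nth mult_single atLeast0AtMost mult.commute)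

lemma kernel_nth:
  "fps_nth kernel n = (\<Sum>i\<le>n. lmono (int n - 2 * int i) (kernel_coeff i (n - i))
     - lmono (2 * int i - int n - 1) (kernel_coeff i (n - i)))"
proof -
  have "fps_nth (expz (lmono (-1) [:0, 1:] + lmono 1 [:-1, 1:])) n =
      (\<Sum>i\<le>n. lmono (int n - 2 * int i) (kernel_coeff i (n - i)))"
    unfolding expz_binomial_nth kernel_coeff_def
    by (intro sum.cong refl arg_cong2[of _ _ _ _ lmono]) (auto simp: of_nat_diff)
  moreover have "fps_nth (ubar * expz (lmono 1 [:0, 1:] + lmono (-1) [:-1, 1:])) n =
      (\<Sum>i\<le>n. lmono (2 * int i - int n - 1) (kernel_coeff i (n - i)))"
    unfolding ubar_def fps_mult_left_const_nth expz_binomial_nth sum_distrib_left mult_single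
      mult_1 kernel_coeff_def
    by (intro sum.cong refl arg_cong2[of _ _ _ _ lmono]) (auto simp: of_nat_diff)
  ultimately show ?thesis by (simp add: kernel_def sum_subtractf)
qed

text \<open>In the expansion of \<open>kernel_nth\<close> the terms \<open>u^k\<close> and \<open>- u^(-k-1)\<close> come in pairs with equal
coefficients; \<open>k = 0\<close> and \<open>k = -1\<close> are the pairs that matter here.\<close>

lemma kernel_antisym: "Poly_Mapping.lookup (fps_nth kernel n) (-1) = - Poly_Mapping.lookup (fps_nth kernel n) 0"
  unfolding kernel_nth lookup_sum sum_negf[symmetric]
  by (rule sum.cong) (auto simp: lookup_minus lookup_single when_def)

lemma nonneg_part_add: "nonneg_part (p + q) = nonneg_part p + nonneg_part q"
  by (rule poly_mapping_eqI) (simp add: lookup_nonneg_part lookup_add)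

lemma nonneg_part_single: "nonneg_part (lmono i c) = (if 0 \<le> i then lmono i c else 0)"
  by (rule poly_mapping_eqI) (auto simp: lookup_nonneg_part lookup_single when_def)

lemma nonneg_part_diff: "nonneg_part (p - q) = nonneg_part p - nonneg_part q"
  by (rule poly_mapping_eqI) (simp add: lookup_nonneg_part lookup_minus)

lemma kernel_pos_nth:
  "fps_nth kernel_pos n = (\<Sum>i\<le>n. if 2 * i \<le> n then lmono (int n - 2 * int i) (kernel_coeff i (n - i))
     else - lmono (2 * int i - int n - 1) (kernel_coeff i (n - i)))"
  unfolding kernel_pos_def nonneg_part_fps_def fps_nth_Abs_fps kernel_nth
    additive_sum[of nonneg_part, OF nonneg_part_add] nonneg_part_diff nonneg_part_single
  by (rule sum.cong) auto

text \<open>Multiplication by \<open>u + 1/u\<close> and restriction to non-negative exponents commute up to boundary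
terms: the coefficient of \<open>1/u\<close> enters in degree \<open>0\<close>, and the coefficient of \<open>u^0\<close> must be
prevented from leaving to degree \<open>-1\<close>. By the hypothesis both are multiples of the coefficient
of \<open>u^0\<close>.\<close>

lemma nonneg_part_neighbours:
  assumes "Poly_Mapping.lookup p (-1) = - Poly_Mapping.lookup p 0"
  shows "nonneg_part ((lmono 1 1 + lmono (-1) 1) * p) =
    (lmono 1 1 + lmono (-1) 1) * nonneg_part p - (1 + lmono (-1) 1) * coeff_u0 p"
proof (rule poly_mapping_eqI)
  fix k :: int
  consider "k < -1" | "k = -1" | "k = 0" | "0 < k" by linarith
  then show "Poly_Mapping.lookup (nonneg_part ((lmono 1 1 + lmono (-1) 1) * p)) k =
    Poly_Mapping.lookup ((lmono 1 1 + lmono (-1) 1) * nonneg_part p - (1 + lmono (-1) 1) * coeff_u0 p) k"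
    using assms
    by cases (simp_all add: lookup_nonneg_part distrib_right lookup_add lookup_minus lookup_lmono_mult
        coeff_u0_def mult_single lookup_single when_def)
qed

lemma uv_plus_ubar: "uv + ubar = fps_const (lmono 1 1 + lmono (-1) 1)"
  by (simp add: uv_def ubar_def)

lemma poly_u_kernel_pos: "poly_u kernel_pos"
  by (simp add: kernel_pos_def nonneg_part_fps_def polynomial_in_u_iff lookup_nonneg_part)

lemma dy_zv [simp]: "dy zv = 0" and dy_uv [simp]: "dy uv = 0" and dy_ubar [simp]: "dy ubar = 0"
  and dy_yv [simp]: "dy yv = 1"
  by (simp_all add: zv_def uv_def ubar_def yv_def coeffwise_const pderiv_1 pderiv_pCons
      flip: one_pCons, simp_all add: fps_eq_iff fps_X_def)

lemma dy_diff: "dy (F - G) = dy F - dy G"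
  using dy_add[of "F - G" G] by simp

text \<open>Both exponents have the derivative \<open>z (u + 1/u)\<close> in \<open>y\<close>.\<close>

lemma dy_kernel: "dy kernel = zv * ((uv + ubar) * kernel)"
proof -
  have "pderiv_y (lmono (-1) [:0, 1:] + lmono 1 [:-1, 1:]) = lmono 1 1 + lmono (-1) 1"
    "pderiv_y (lmono 1 [:0, 1:] + lmono (-1) [:-1, 1:]) = lmono 1 1 + lmono (-1) 1"
    by (simp_all add: pderiv_y_add pderiv_pCons add.commute flip: one_pCons)
  then have "dy (expz (lmono (-1) [:0, 1:] + lmono 1 [:-1, 1:])) =
      zv * (uv + ubar) * expz (lmono (-1) [:0, 1:] + lmono 1 [:-1, 1:])"
    "dy (expz (lmono 1 [:0, 1:] + lmono (-1) [:-1, 1:])) =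
      zv * (uv + ubar) * expz (lmono 1 [:0, 1:] + lmono (-1) [:-1, 1:])"
    by (simp_all only: dy_expz uv_plus_ubar)
  then show ?thesis
    by (simp add: kernel_def dy_diff dy_mult right_diff_distrib mult_ac)
qed

lemma dy_nonneg: "dy (nonneg_part_fps G) = nonneg_part_fps (dy G)"
  by (rule fps_ext, rule poly_mapping_eqI)
    (simp add: nonneg_part_fps_def lookup_pderiv_y lookup_nonneg_part)

lemma nonneg_zv_mult: "nonneg_part_fps (zv * G) = zv * nonneg_part_fps G"
proof -
  have "nonneg_part 0 = 0" by (simp add: nonneg_part_def)
  then show ?thesis by (intro fps_ext) (simp add: nonneg_part_fps_def zv_def)
qed

lemma at_u0_kernel_pos: "at_u0 kernel_pos = at_u0 kernel"
  by (rule fps_ext) (simp add: kernel_pos_def nonneg_part_fps_def coeff_u0_def lookup_nonneg_part)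

lemma dy_kernel_pos:
  "dy kernel_pos = zv * ((uv + ubar) * kernel_pos - (1 + ubar) * at_u0 kernel_pos)"
proof -
  have "nonneg_part_fps ((uv + ubar) * kernel) = (uv + ubar) * kernel_pos - (1 + ubar) * at_u0 kernel"
  proof (rule fps_ext)
    fix n
    have "1 + ubar = fps_const (1 + lmono (-1) 1)" by (simp add: ubar_def flip: fps_const_add)
    then show "fps_nth (nonneg_part_fps ((uv + ubar) * kernel)) n =
      fps_nth ((uv + ubar) * kernel_pos - (1 + ubar) * at_u0 kernel) n"
      using nonneg_part_neighbours[OF kernel_antisym[of n]]
      by (simp add: uv_plus_ubar nonneg_part_fps_def kernel_pos_def)
  qed
  then show ?thesis
    by (simp add: kernel_pos_def[THEN arg_cong[of _ _ dy]] dy_nonneg dy_kernel nonneg_zv_mult at_u0_kernel_pos)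
qed

text \<open>The closed form of the theorem, which is shown below to solve the functional equation.\<close>

definition tamari_sol :: "laurent fps" where
  "tamari_sol = (1 + uv) * expz (lmono 0 [:0, 2:]) * kernel_pos"

lemma poly_u_tamari_sol: "poly_u tamari_sol"
  unfolding tamari_sol_def uv_def
  by (intro poly_u_mult poly_u_add poly_u_1 poly_u_const poly_u_expz poly_u_kernel_pos polynomial_in_u_single) simp_all

lemma at_u0_uv: "at_u0 uv = 0"
  by (simp add: uv_def coeffwise_const coeff_u0_single)

lemma at_u0_tamari_sol: "at_u0 tamari_sol = expz (lmono 0 [:0, 2:]) * at_u0 kernel_pos"
proof -
  have 1: "poly_u (1 + uv)" unfolding uv_def
    by (intro poly_u_add poly_u_1 poly_u_const polynomial_in_u_single) simp
  have 2: "poly_u (expz (lmono 0 [:0, 2:]))" by (intro poly_u_expz polynomial_in_u_single) simp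
  have "at_u0 tamari_sol = at_u0 (1 + uv) * at_u0 (expz (lmono 0 [:0, 2:])) * at_u0 kernel_pos"
    unfolding tamari_sol_def
    using at_u0_mult[OF 1 2] at_u0_mult[OF poly_u_mult[OF 1 2] poly_u_kernel_pos] by simp
  then show ?thesis
    by (simp add: at_u0_add at_u0_uv at_u0_expz polynomial_in_u_single coeff_u0_single)
qed

lemma single_pCons_2: "lmono 0 [:2:] = 2"
  by (simp flip: numeral_poly)

text \<open>The factor \<open>e^(2yz)\<close> adds \<open>2z\<close> to the coefficient \<open>z (u + 1/u)\<close> of the equation for the
non-negative part, and \<open>2 + u + 1/u = (1 + u) (1 + 1/u)\<close>.\<close>

lemma dy_tamari_sol:
  "dy tamari_sol = zv * (1 + uv) * (1 + ubar) * (tamari_sol - at_u0 tamari_sol)"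
proof -
  let ?E = "expz (lmono 0 [:0, 2:])"
  have "dy ?E = 2 * zv * ?E"
    by (simp add: dy_expz pderiv_pCons single_pCons_2 flip: numeral_fps_const)
  then have "dy tamari_sol = (1 + uv) * ?E * (2 * zv * kernel_pos + zv * ((uv + ubar) * kernel_pos - (1 + ubar) * at_u0 kernel_pos))"
    by (simp add: tamari_sol_def dy_mult dy_add dy_kernel_pos) (simp add: algebra_simps)
  also have "\<dots> = (1 + uv) * ?E * zv * ((1 + uv + ubar + uv * ubar) * kernel_pos - (1 + ubar) * at_u0 kernel_pos)"
  proof -
    have "1 + uv + ubar + uv * ubar = 2 + (uv + ubar)" by (simp add: uv_ubar)
    then show ?thesis by (simp only:) (simp add: algebra_simps)
  qed
  also have "\<dots> = zv * (1 + uv) * (1 + ubar) * (tamari_sol - at_u0 tamari_sol)"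
    by (simp add: at_u0_tamari_sol) (simp add: tamari_sol_def algebra_simps)
  finally show ?thesis .
qed

lemma at_y_zv_uv_ubar [simp]: "at_y a zv = zv" "at_y a uv = uv" "at_y a ubar = ubar"
  by (simp_all add: zv_def uv_def ubar_def coeffwise_const flip: one_pCons)
    (simp add: fps_eq_iff fps_X_def)

text \<open>For \<open>a = 0\<close> and for \<open>a = 1\<close> only one summand survives in each degree.\<close>

lemma subst_y_kernel_pos:
  "fps_nth (at_y a kernel_pos) n = (\<Sum>i\<le>n.
     if 2 * i \<le> n then lmono (int n - 2 * int i) [:a ^ i * (a - 1) ^ (n - i) / (fact i * fact (n - i)):]
     else - lmono (2 * int i - int n - 1) [:a ^ i * (a - 1) ^ (n - i) / (fact i * fact (n - i)):])"
proof -
  have "subst_y a (- lmono i c) = - lmono i [:poly c a:]" for i c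
    using subst_y_add[of a "lmono i c" "- lmono i c"] by (simp add: eq_neg_iff_add_eq_0 add.commute)
  then show ?thesis
    by (simp add: kernel_pos_nth additive_sum[of "subst_y a", OF subst_y_add] if_distrib[of "subst_y a"]
        kernel_coeff_def poly_power cong: if_cong)
qed

lemma at_y_0_kernel_pos: "at_y 0 kernel_pos = expz (lmono 1 (-1))"
proof (rule fps_ext)
  fix n
  have "fps_nth (at_y 0 kernel_pos) n = (\<Sum>i\<le>n. if i = 0 then lmono (int n) [:(-1) ^ n / fact n:] else 0)"
    unfolding subst_y_kernel_pos by (rule sum.cong) (auto simp: power_0_left)
  also have "\<dots> = fps_nth (expz (lmono 1 (-1))) n"
  proof -
    have "[:(-1) ^ n / fact n:] = smult (1 / fact n :: rat) ((-1) ^ n)"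
      by (cases "even n") simp_all
    then show ?thesis by (simp add: expz_lmono_nth)
  qed
  finally show "fps_nth (at_y 0 kernel_pos) n = fps_nth (expz (lmono 1 (-1))) n" .
qed

lemma at_y_1_kernel_pos: "uv * at_y 1 kernel_pos = 1 + uv - expz (lmono 1 1)"
proof (rule fps_ext)
  fix n
  have "fps_nth (at_y 1 kernel_pos) n = (\<Sum>i\<le>n. if i = n then
      (if n = 0 then 1 else - lmono (int n - 1) [:1 / fact n:]) else 0)"
    unfolding subst_y_kernel_pos by (rule sum.cong) (auto simp: power_0_left simp flip: one_pCons)
  then have "fps_nth (at_y 1 kernel_pos) n = (if n = 0 then 1 else - lmono (int n - 1) [:1 / fact n:])"
    by simp
  then show "fps_nth (uv * at_y 1 kernel_pos) n = fps_nth (1 + uv - expz (lmono 1 1)) n"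
    by (simp add: uv_def expz_lmono_nth mult_single fps_one_nth flip: one_pCons)
qed

lemma at_y_0_tamari_sol: "at_y 0 tamari_sol = (1 + uv) * expz (lmono 1 (-1))"
  by (simp add: tamari_sol_def at_y_mult at_y_add at_y_0_kernel_pos at_y_expz)

lemma at_y_1_tamari_sol:
  "uv * at_y 1 tamari_sol = (1 + uv) * expz (lmono 0 [:2:]) * (1 + uv - expz (lmono 1 1))"
  by (simp add: tamari_sol_def at_y_mult at_y_add at_y_expz mult.left_commute[of uv] at_y_1_kernel_pos)

text \<open>Only finitely many terms of the family contribute to a given power of the variable, and as soon
as a finite partial sum contains them, that coefficient is final.\<close>

lemma has_sum_monomials:
  fixes a :: "nat \<Rightarrow> nat \<Rightarrow> 'a :: comm_ring_1"
  shows "((\<lambda>(i, j). fps_const (a i j) * fps_X ^ (i + j)) has_sum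
     Abs_fps (\<lambda>n. \<Sum>i | i \<le> n \<and> (i, n - i) \<in> S. a i (n - i))) S"
  unfolding has_sum_def tendsto_fps_iff
proof
  fix n
  define X where "X = {(i, j). (i, j) \<in> S \<and> i + j = n}"
  have X: "X = (\<lambda>i. (i, n - i)) ` {i. i \<le> n \<and> (i, n - i) \<in> S}"
    by (auto simp: X_def image_iff)
  have "finite X" unfolding X by simp
  have sumX: "(\<Sum>(i, j)\<in>X. a i j) = (\<Sum>i | i \<le> n \<and> (i, n - i) \<in> S. a i (n - i))"
    unfolding X by (subst sum.reindex) (auto simp: inj_on_def)
  show "\<forall>\<^sub>F F in finite_subsets_at_top S. fps_nth (\<Sum>(i, j)\<in>F. fps_const (a i j) * fps_X ^ (i + j)) n =
     fps_nth (Abs_fps (\<lambda>n. \<Sum>i | i \<le> n \<and> (i, n - i) \<in> S. a i (n - i))) n"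
    unfolding eventually_finite_subsets_at_top
  proof (intro exI[of _ X] conjI allI impI)
    fix Y assume Y: "finite Y \<and> X \<subseteq> Y \<and> Y \<subseteq> S"
    have "fps_nth (\<Sum>(i, j)\<in>Y. fps_const (a i j) * fps_X ^ (i + j)) n =
      (\<Sum>(i, j)\<in>Y. if i + j = n then a i j else 0)"
      by (auto simp: fps_sum_nth case_prod_beta intro!: sum.cong)
    also have "\<dots> = (\<Sum>(i, j)\<in>X. if i + j = n then a i j else 0)"
      using Y by (intro sum.mono_neutral_right) (auto simp: X_def split: if_splits)
    also have "\<dots> = (\<Sum>(i, j)\<in>X. a i j)"
      by (intro sum.cong) (auto simp: X_def)
    finally show "fps_nth (\<Sum>(i, j)\<in>Y. fps_const (a i j) * fps_X ^ (i + j)) n =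
      fps_nth (Abs_fps (\<lambda>n. \<Sum>i | i \<le> n \<and> (i, n - i) \<in> S. a i (n - i))) n"
      by (simp add: sumX)
  qed (use \<open>finite X\<close> in \<open>auto simp: X_def\<close>)
qed

lemma series_term:
  "uv ^ k * zv ^ (i + j) * yv ^ i * (yv - 1) ^ j * rat_fps (1 / (fact i * fact j))
    = fps_const (lmono (int k) (kernel_coeff i j)) * fps_X ^ (i + j)"
  unfolding yv_minus_1
  by (simp add: uv_def zv_def yv_def rat_fps_def rat_laurent_def fps_const_power lmono_power
      mult_single kernel_coeff_def mult.commute mult.left_commute)

text \<open>The two sums collect the terms of \<open>kernel_pos_nth\<close>: the exponent \<open>j - i\<close> is non-negative for
\<open>i \<le> j\<close>, and \<open>i - j - 1\<close> is non-negative for \<open>j < i\<close>. In both ranges the truncated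
subtraction of natural numbers is the true one.\<close>

lemma kernel_pos_series:
  "\<exists>A B.
      ((\<lambda>(i, j). uv ^ (j - i) * zv ^ (i + j) * yv ^ i * (yv - 1) ^ j
          * rat_fps (1 / (fact i * fact j))) has_sum A) {(i, j). i \<le> j} \<and>
      ((\<lambda>(i, j). uv ^ (i - j - 1) * zv ^ (i + j) * yv ^ i * (yv - 1) ^ j
          * rat_fps (1 / (fact i * fact j))) has_sum B) {(i, j). j < i} \<and>
      kernel_pos = A - B"
proof -
  define a where "a i j = lmono (int (j - i)) (kernel_coeff i j)" for i j :: nat
  define b where "b i j = lmono (int (i - j - 1)) (kernel_coeff i j)" for i j :: nat
  define A where "A = Abs_fps (\<lambda>n. \<Sum>i | i \<le> n \<and> (i, n - i) \<in> {(i, j). i \<le> j}. a i (n - i))"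
  define B where "B = Abs_fps (\<lambda>n. \<Sum>i | i \<le> n \<and> (i, n - i) \<in> {(i, j). j < i}. b i (n - i))"
  have "kernel_pos = A - B"
  proof (rule fps_ext)
    fix n
    have "fps_nth A n = (\<Sum>i\<le>n. if 2 * i \<le> n then a i (n - i) else 0)"
      unfolding A_def by (simp add: sum.If_cases Collect_conj_eq flip: sum.inter_filter)
        (intro sum.cong, auto)
    moreover have "fps_nth B n = (\<Sum>i\<le>n. if 2 * i \<le> n then 0 else b i (n - i))"
      unfolding B_def by (simp add: sum.If_cases Collect_conj_eq flip: sum.inter_filter)
        (intro sum.cong, auto)
    ultimately have "fps_nth (A - B) n = (\<Sum>i\<le>n. (if 2 * i \<le> n then a i (n - i) else 0) - (if 2 * i \<le> n then 0 else b i (n - i)))"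
      by (simp add: sum_subtractf)
    also have "\<dots> = fps_nth kernel_pos n"
      unfolding kernel_pos_nth a_def b_def by (rule sum.cong) (auto simp: of_nat_diff algebra_simps)
    finally show "fps_nth kernel_pos n = fps_nth (A - B) n" by simp
  qed
  then show ?thesis
    using has_sum_monomials[of a "{(i, j). i \<le> j}"] has_sum_monomials[of b "{(i, j). j < i}"]
    unfolding series_term a_def b_def A_def B_def by blast
qed

section \<open>Specialization of the generating function\<close>

text \<open>The coefficient of \<open>t^n\<close>, already specialized at a series for \<open>x\<close>.\<close>

definition interval_series :: "laurent fps \<Rightarrow> nat \<Rightarrow> laurent fps" where
  "interval_series x n = (\<Sum>(p, q)\<in>intervals n. rat_fps (weight q) * yv ^ first_run q * x ^ touches p)"

lemma rat_fps_hom: "rat_fps (a + b) = rat_fps a + rat_fps b" "rat_fps 0 = 0"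
  "rat_fps (a * b) = rat_fps a * rat_fps b" "rat_fps 1 = 1"
proof -
  show "rat_fps (a + b) = rat_fps a + rat_fps b"
    by (simp add: rat_fps_def rat_laurent_def flip: single_add)
  show "rat_fps 0 = 0" by (simp add: rat_fps_def rat_laurent_def)
qed (simp_all add: rat_fps_def rat_laurent_mult)

lemma rat_fps_of_nat: "rat_fps (of_nat n) = of_nat n"
  by (simp add: rat_fps_def rat_laurent_of_nat fps_of_nat)

lemma map_poly_add:
  assumes "\<And>a b. f (a + b) = f a + (f b :: 'b :: ab_group_add)"
  shows "map_poly f (p + q :: 'a :: ab_group_add poly) = map_poly f p + map_poly f q"
  using additive_0[of f, OF assms] by (intro poly_eqI) (simp add: coeff_map_poly assms)

lemma eval_xy_add: "eval_xy x y (p + q) = eval_xy x y p + eval_xy x y q"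
  unfolding eval_xy_def
  by (subst map_poly_add) (simp_all add: map_poly_add rat_fps_hom(1))

lemma eval_xy_monom: "eval_xy x y (monom (monom c i) j) = rat_fps c * x ^ i * y ^ j"
  unfolding eval_xy_def by (simp add: map_poly_monom rat_fps_hom poly_monom)

lemma eval_xy_tamari_gf: "eval_xy x yv (fps_nth tamari_gf n) = interval_series x n"
  unfolding tamari_gf_nth interval_series_def additive_sum[of "eval_xy x yv", OF eval_xy_add]
  by (simp add: case_prod_beta eval_xy_monom mult_ac)

lemma intervals_0: "intervals 0 = {(Leaf, Leaf)}"
proof -
  have "nodes t = 0 \<longleftrightarrow> t = Leaf" for t by (cases t) auto
  then show ?thesis unfolding intervals_def using tle_nodes by fastforce
qed

lemma interval_series_0: "interval_series x 0 = x"
  by (simp add: interval_series_def intervals_0 rat_fps_hom)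

lemma dy_rat_fps [simp]: "dy (rat_fps q) = 0" and at_y_rat_fps [simp]: "at_y a (rat_fps q) = rat_fps q"
  by (simp_all add: rat_fps_def coeffwise_const)

lemma at_y_yv: "at_y a yv = rat_fps a"
  by (simp add: yv_def rat_fps_def rat_laurent_def coeffwise_const)

text \<open>The features of the substitution on which the functional equation depends: the assumption \<open>t_0\<close>
makes power series in \<open>t\<close> converge, and \<open>at_u0_x\<close> lets \<open>u = 0\<close> stand for \<open>x = 1\<close>.\<close>

locale specialization =
  fixes t x :: "laurent fps"
  assumes dy_x: "dy x = 0" and at_y_x: "\<And>a. at_y a x = x" and poly_u_x: "poly_u x" and at_u0_x: "at_u0 x = 1"
    and dy_t: "dy t = 0" and at_y_t: "\<And>a. at_y a t = t" and poly_u_t: "poly_u t" and at_u0_t: "at_u0 t = t"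
    and t_0: "fps_nth t 0 = 0"
begin

lemma at_y_1_interval_series:
  "at_y 1 (interval_series x n) = (\<Sum>(p, q)\<in>intervals n. rat_fps (weight q) * x ^ touches p)"
  by (simp add: interval_series_def at_y_sum at_y_mult at_y_power at_y_x at_y_yv case_prod_beta rat_fps_hom)

text \<open>A nonempty upper path starts with a north step.\<close>

lemma at_y_0_interval_series:
  "at_y 0 (interval_series x n) = (if n = 0 then x else 0)"
proof -
  have pos: "first_run q \<noteq> 0" if "(p, q) \<in> intervals n" "n > 0" for p q
    using that by (cases q) (auto simp: intervals_def)
  then have "at_y 0 (interval_series x n) = 0" if "n > 0"
    unfolding interval_series_def at_y_sum
  proof (intro sum.neutral ballI)
    fix pq assume "pq \<in> intervals n"
    then have "first_run (snd pq) \<noteq> 0" using pos[of "fst pq" "snd pq"] that by simp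
    then show "at_y 0 (case pq of (p, q) \<Rightarrow> rat_fps (weight q) * yv ^ first_run q * x ^ touches p) = 0"
      by (simp add: case_prod_beta at_y_mult at_y_power at_y_yv rat_fps_hom power_0_left)
  qed
  then show ?thesis using interval_series_0 at_y_x by auto
qed

lemma poly_u_rat: "poly_u (rat_fps q)"
  unfolding rat_fps_def by (intro poly_u_const) simp

lemma poly_u_yv: "poly_u yv"
  unfolding yv_def by (intro poly_u_const polynomial_in_u_single) simp

lemma poly_u_sum: "(\<And>i. i \<in> I \<Longrightarrow> poly_u (f i)) \<Longrightarrow> poly_u (sum f I)"
  by (simp add: fps_sum_nth polynomial_in_u_sum)

lemma poly_u_interval_series: "poly_u (interval_series x n)"
  unfolding interval_series_def case_prod_beta
  by (intro poly_u_sum poly_u_mult poly_u_power poly_u_x poly_u_yv poly_u_rat)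

lemma at_u0_interval_series:
  "at_u0 (interval_series x n) = (\<Sum>(p, q)\<in>intervals n. rat_fps (weight q) * yv ^ first_run q)"
proof -
  have "at_u0 (rat_fps c * yv ^ i * x ^ j) = rat_fps c * yv ^ i" for c i j
  proof -
    have "at_u0 (rat_fps c) = rat_fps c" "at_u0 yv = yv"
      by (simp_all add: rat_fps_def rat_laurent_def yv_def coeffwise_const coeff_u0_single)
    then show ?thesis
      using at_u0_mult[OF poly_u_mult[OF poly_u_rat poly_u_power[OF poly_u_yv]] poly_u_power[OF poly_u_x]]
        at_u0_mult[OF poly_u_rat poly_u_power[OF poly_u_yv]]
      by (simp add: at_u0_power[OF poly_u_x] at_u0_power[OF poly_u_yv] at_u0_x)
  qed
  then show ?thesis by (simp add: interval_series_def at_u0_sum case_prod_beta)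
qed

lemma dy_interval_series:
  "dy (interval_series x n) =
    (\<Sum>(p, q)\<in>intervals n. (of_nat (first_run q) * rat_fps (weight q) * yv ^ (first_run q - 1)) * x ^ touches p)"
  unfolding interval_series_def dy_sum case_prod_beta
  by (rule sum.cong) (simp_all add: dy_mult dy_power dy_x mult_ac)

text \<open>The functional equation in degree \<open>n + 1\<close>. Differentiation in \<open>y\<close> multiplies the weight of
\<open>N q1 E q2\<close> by the length of its first run, and leaves the product of the weights of \<open>q1\<close> and
\<open>q2\<close> with the power of \<open>y\<close> that belongs to \<open>q1\<close>. So \<open>q1\<close> carries \<open>y\<close>, whereas the other factor
is taken at \<open>y = 1\<close>; the difference \<open>x^c - 1\<close> of \<open>sum_intervals_Suc\<close> is a difference between
the values at a general \<open>x\<close> and at \<open>x = 1\<close>, that is, at \<open>u = 0\<close>.\<close>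

lemma interval_series_Suc:
  "(x - 1) * dy (interval_series x (Suc n)) = x * (\<Sum>k\<le>n.
     (interval_series x k - at_u0 (interval_series x k)) * at_y 1 (interval_series x (n - k)))"
proof -
  let ?h = "\<lambda>q. of_nat (first_run q) * rat_fps (weight q) * yv ^ (first_run q - 1)"
  have h: "?h (Node q1 q2) = rat_fps (weight q1) * rat_fps (weight q2) * yv ^ first_run q1" for q1 q2
  proof -
    have "of_nat (first_run (Node q1 q2)) * weight (Node q1 q2) = weight q1 * weight q2"
      by (simp del: of_nat_Suc)
    then have "of_nat (first_run (Node q1 q2)) * rat_fps (weight (Node q1 q2)) = rat_fps (weight q1) * rat_fps (weight q2)"
      by (metis rat_fps_hom(3) rat_fps_of_nat)
    then show ?thesis by simp
  qed
  have "(\<Sum>(p1, q1)\<in>intervals k. \<Sum>(p2, q2)\<in>intervals (n - k).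
       ?h (Node q1 q2) * (x ^ touches p1 - 1) * x ^ touches p2) =
     (interval_series x k - at_u0 (interval_series x k)) * at_y 1 (interval_series x (n - k))" for k
    unfolding h at_u0_interval_series at_y_1_interval_series
    unfolding interval_series_def sum_subtractf[symmetric] case_prod_beta sum_product
    by (intro sum.cong refl) (simp add: algebra_simps)
  then show ?thesis
    unfolding dy_interval_series sum_intervals_Suc[where h = ?h] by simp
qed

text \<open>The series \<open>a 0 + a 1 t + a 2 t^2 + ...\<close>; as \<open>t = O(z)\<close>, each coefficient in \<open>z\<close>
is a finite sum (\<open>subst_t_nth\<close>).\<close>

definition subst_t :: "(nat \<Rightarrow> laurent fps) \<Rightarrow> laurent fps" where
  "subst_t a = Abs_fps (\<lambda>m. fps_nth (\<Sum>n\<le>m. a n * t ^ n) m)"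

lemma t_power_nth: "m < n \<Longrightarrow> fps_nth (a * t ^ n) m = 0"
  using startsby_zero_power_prefix[OF t_0] by (simp add: fps_mult_nth)

lemma subst_t_nth: "m \<le> N \<Longrightarrow> fps_nth (subst_t a) m = fps_nth (\<Sum>n\<le>N. a n * t ^ n) m"
  unfolding subst_t_def fps_nth_Abs_fps fps_sum_nth
  by (rule sum.mono_neutral_left) (auto simp: t_power_nth)

lemma subst_t_sums: "(\<lambda>n. a n * t ^ n) sums subst_t a"
  unfolding sums_def
proof (rule tendsto_fpsI)
  fix m
  show "\<forall>\<^sub>F N in sequentially. fps_nth (\<Sum>n<N. a n * t ^ n) m = fps_nth (subst_t a) m"
    using eventually_gt_at_top[of m]
  proof eventually_elim
    case (elim N)
    then show ?case using subst_t_nth[of m "N - 1" a] lessThan_Suc_atMost[of "N - 1"] by simp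
  qed
qed

lemma fps_mult_nth_cong:
  "(\<And>i. i \<le> m \<Longrightarrow> fps_nth F i = fps_nth F' i) \<Longrightarrow> (\<And>i. i \<le> m \<Longrightarrow> fps_nth G i = fps_nth G' i) \<Longrightarrow>
    fps_nth (F * G) m = fps_nth (F' * G' :: laurent fps) m"
  by (simp add: fps_mult_nth)

lemma subst_t_smult: "c * subst_t a = subst_t (\<lambda>n. c * a n)"
proof (rule fps_ext)
  fix m
  have "fps_nth (c * subst_t a) m = fps_nth (c * (\<Sum>n\<le>m. a n * t ^ n)) m"
    by (rule fps_mult_nth_cong) (simp_all add: subst_t_nth)
  then show "fps_nth (c * subst_t a) m = fps_nth (subst_t (\<lambda>n. c * a n)) m"
    by (simp add: subst_t_def sum_distrib_left mult.assoc)
qed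

lemma subst_t_diff: "subst_t a - subst_t b = subst_t (\<lambda>n. a n - b n)"
  by (rule fps_ext) (simp add: subst_t_def fps_sum_nth sum_subtractf left_diff_distrib)

lemma subst_t_mult: "subst_t a * subst_t b = subst_t (\<lambda>n. \<Sum>k\<le>n. a k * b (n - k))"
proof (rule fps_ext)
  fix m
  have "fps_nth (subst_t a * subst_t b) m = fps_nth ((\<Sum>n\<le>m. a n * t ^ n) * (\<Sum>n\<le>m. b n * t ^ n)) m"
    by (rule fps_mult_nth_cong) (simp_all add: subst_t_nth)
  also have "\<dots> = (\<Sum>(i, j)\<in>{..m} \<times> {..m}. fps_nth (a i * b j * t ^ (i + j)) m)"
    by (auto simp: sum_product fps_sum_nth sum.cartesian_product power_add mult_ac intro!: sum.cong)
  also have "\<dots> = (\<Sum>(i, j)\<in>{(i, j). i + j \<le> m}. fps_nth (a i * b j * t ^ (i + j)) m)"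
  proof (rule sum.mono_neutral_right)
    show "\<forall>s\<in>{..m} \<times> {..m} - {(i, j). i + j \<le> m}.
        (case s of (i, j) \<Rightarrow> fps_nth (a i * b j * t ^ (i + j)) m) = 0"
    proof
      fix s assume "s \<in> {..m} \<times> {..m} - {(i, j). i + j \<le> m}"
      then have "m < fst s + snd s" by auto
      then show "(case s of (i, j) \<Rightarrow> fps_nth (a i * b j * t ^ (i + j)) m) = 0"
        unfolding case_prod_beta by (rule t_power_nth)
    qed
  qed auto
  also have "\<dots> = (\<Sum>n\<le>m. \<Sum>k\<le>n. fps_nth (a k * b (n - k) * t ^ (k + (n - k))) m)"
    by (rule sum.triangle_reindex_eq)
  also have "\<dots> = fps_nth (subst_t (\<lambda>n. \<Sum>k\<le>n. a k * b (n - k))) m"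
    by (simp add: subst_t_def fps_sum_nth sum_distrib_right)
  finally show "fps_nth (subst_t a * subst_t b) m = fps_nth (subst_t (\<lambda>n. \<Sum>k\<le>n. a k * b (n - k))) m" .
qed

lemma subst_t_shift: "t * subst_t a = subst_t (\<lambda>n. case n of 0 \<Rightarrow> 0 | Suc k \<Rightarrow> a k)"
proof (rule fps_ext)
  fix m
  have "fps_nth (t * subst_t a) m = fps_nth (t * (\<Sum>n\<le>m. a n * t ^ n)) m"
    by (rule fps_mult_nth_cong) (simp_all add: subst_t_nth)
  also have "\<dots> = fps_nth (\<Sum>n\<le>Suc m. (case n of 0 \<Rightarrow> 0 | Suc k \<Rightarrow> a k) * t ^ n) m"
    unfolding sum.atMost_Suc_shift by (simp add: sum_distrib_left mult_ac)
  also have "\<dots> = fps_nth (subst_t (\<lambda>n. case n of 0 \<Rightarrow> 0 | Suc k \<Rightarrow> a k)) m"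
    by (rule subst_t_nth[symmetric]) simp
  finally show "fps_nth (t * subst_t a) m = fps_nth (subst_t (\<lambda>n. case n of 0 \<Rightarrow> 0 | Suc k \<Rightarrow> a k)) m" .
qed

text \<open>An additive operator for which the powers of \<open>t\<close> are scalars acts termwise.\<close>

lemma coeffwise_subst_t:
  assumes "\<And>p q. D (p + q) = D p + D q" and "\<And>n. coeffwise D (a n * t ^ n) = coeffwise D (a n) * t ^ n"
  shows "coeffwise D (subst_t a) = subst_t (\<lambda>n. coeffwise D (a n))"
proof (rule fps_ext)
  fix m
  have "fps_nth (coeffwise D (subst_t a)) m = fps_nth (coeffwise D (\<Sum>n\<le>m. a n * t ^ n)) m"
    by (simp add: subst_t_def)
  also have "\<dots> = fps_nth (subst_t (\<lambda>n. coeffwise D (a n))) m"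
    by (simp only: coeffwise_sum[of D, OF assms(1)] assms(2)) (simp add: subst_t_def)
  finally show "fps_nth (coeffwise D (subst_t a)) m = fps_nth (subst_t (\<lambda>n. coeffwise D (a n))) m" .
qed

lemma dy_subst_t: "dy (subst_t a) = subst_t (\<lambda>n. dy (a n))"
  by (rule coeffwise_subst_t) (simp_all add: pderiv_y_add dy_mult dy_power dy_t)

lemma at_y_subst_t: "at_y c (subst_t a) = subst_t (\<lambda>n. at_y c (a n))"
  by (rule coeffwise_subst_t) (simp_all add: subst_y_add at_y_mult at_y_power at_y_t)

lemma at_u0_subst_t: "(\<And>n. poly_u (a n)) \<Longrightarrow> at_u0 (subst_t a) = subst_t (\<lambda>n. at_u0 (a n))"
  by (rule coeffwise_subst_t)
    (simp_all add: coeff_u0_add at_u0_mult poly_u_power[OF poly_u_t] at_u0_power[OF poly_u_t] at_u0_t)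

text \<open>The functional equation after the substitution; \<open>at_u0 G\<close> plays the role of \<open>F(1, y)\<close>.\<close>

definition is_solution :: "laurent fps \<Rightarrow> bool" where
  "is_solution G \<longleftrightarrow> at_y 0 G = x \<and> (x - 1) * dy G = t * (x * ((G - at_u0 G) * at_y 1 G))"

lemma is_solution_interval_series: "is_solution (subst_t (interval_series x))"
proof -
  let ?F = "subst_t (interval_series x)"
  have "at_y 0 ?F = subst_t (\<lambda>n. if n = 0 then x else 0)"
    unfolding at_y_subst_t at_y_0_interval_series ..
  also have "\<dots> = x"
  proof (rule fps_ext)
    fix m
    have "(\<Sum>n\<le>m. (if n = 0 then x else 0) * t ^ n) = (\<Sum>n\<le>m. if n = 0 then x else 0)"
      by (rule sum.cong) auto
    then show "fps_nth (subst_t (\<lambda>n. if n = 0 then x else 0)) m = fps_nth x m"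
      unfolding subst_t_def by simp
  qed
  finally have 1: "at_y 0 ?F = x" .
  have "(x - 1) * dy ?F = subst_t (\<lambda>n. (x - 1) * dy (interval_series x n))"
    unfolding dy_subst_t subst_t_smult ..
  also have "(\<lambda>n. (x - 1) * dy (interval_series x n)) = (\<lambda>n. case n of 0 \<Rightarrow> 0 | Suc n \<Rightarrow>
     x * (\<Sum>k\<le>n. (interval_series x k - at_u0 (interval_series x k)) * at_y 1 (interval_series x (n - k))))"
    by (rule ext) (auto simp: interval_series_Suc interval_series_0 dy_x split: nat.split)
  also have "subst_t \<dots> = t * (x * ((?F - at_u0 ?F) * at_y 1 ?F))"
  proof -
    have "?F - at_u0 ?F = subst_t (\<lambda>n. interval_series x n - at_u0 (interval_series x n))"
      unfolding at_u0_subst_t[of "interval_series x", OF poly_u_interval_series] subst_t_diff ..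
    then show ?thesis
      unfolding at_y_subst_t by (simp only: subst_t_mult subst_t_smult[of x] subst_t_shift)
  qed
  finally show ?thesis using 1 unfolding is_solution_def by blast
qed

text \<open>In degree \<open>n\<close> the right-hand side only involves coefficients below \<open>n\<close>, as \<open>t = O(z)\<close>. On
the left, the coefficient of degree \<open>n\<close> is multiplied by the constant term of \<open>x - 1\<close>, which
can be cancelled. So the derivative in \<open>y\<close> is known, and the initial value fixes the rest.\<close>

lemma solution_unique:
  assumes "fps_nth (x - 1) 0 \<noteq> 0" and "is_solution F" "is_solution G"
  shows "F = G"
proof -
  have "fps_nth F n = fps_nth G n" for n
  proof (induction n rule: less_induct)
    case (less n)
    define R where "R G = x * ((G - at_u0 G) * at_y 1 G)" for G
    have R: "fps_nth (R F) m = fps_nth (R G) m" if "m < n" for m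
      unfolding R_def using less that by (intro fps_mult_nth_cong) auto
    have t: "fps_nth (t * R F) n = fps_nth (t * R G) n"
      unfolding fps_mult_nth
    proof (rule sum.cong[OF refl])
      fix i assume "i \<in> {0..n}"
      then show "fps_nth t i * fps_nth (R F) (n - i) = fps_nth t i * fps_nth (R G) (n - i)"
        using t_0 R by (cases "i = 0") auto
    qed
    have dy: "fps_nth ((x - 1) * dy H) n = fps_nth (x - 1) 0 * pderiv_y (fps_nth H n)
       + (\<Sum>i=Suc 0..n. fps_nth (x - 1) i * pderiv_y (fps_nth H (n - i)))" for H
      unfolding fps_mult_nth by (simp add: sum.atLeast_Suc_atMost)
    have "(\<Sum>i=Suc 0..n. fps_nth (x - 1) i * pderiv_y (fps_nth F (n - i))) =
      (\<Sum>i=Suc 0..n. fps_nth (x - 1) i * pderiv_y (fps_nth G (n - i)))"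
      using less by (intro sum.cong) auto
    moreover have "fps_nth ((x - 1) * dy F) n = fps_nth ((x - 1) * dy G) n"
      using assms t unfolding is_solution_def R_def by simp
    ultimately have "fps_nth (x - 1) 0 * pderiv_y (fps_nth F n) = fps_nth (x - 1) 0 * pderiv_y (fps_nth G n)"
      unfolding dy by simp
    then have "pderiv_y (fps_nth F n) = pderiv_y (fps_nth G n)" using assms(1) by simp
    moreover have "subst_y 0 (fps_nth F n) = subst_y 0 (fps_nth G n)"
      using assms unfolding is_solution_def by (metis coeffwise_nth)
    ultimately show ?case by (rule laurent_eqI_pderiv_y)
  qed
  then show ?thesis by (rule fps_ext)
qed

end

section \<open>The generating function of labelled Tamari intervals\<close>

theorem theorem3:
  fixes t x :: "laurent fps"
  assumes t: "t = zv * exp_fps (- 2 * zv)"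
    and x: "x = (1 + uv) * exp_fps (- (zv * uv))"
  shows "\<exists>F. (\<lambda>n. eval_xy x yv (fps_nth tamari_gf n) * t ^ n) sums F \<and>
    (\<forall>n. polynomial_in_u (fps_nth F n)) \<and>
    F = (1 + uv) * exp_fps (2 * yv * zv) *
      nonneg_part_fps (exp_fps (zv * uv * (yv - 1) + zv * yv * ubar)
        - ubar * exp_fps (zv * ubar * (yv - 1) + zv * yv * uv)) \<and>
    (\<exists>A B.
      ((\<lambda>(i, j). uv ^ (j - i) * zv ^ (i + j) * yv ^ i * (yv - 1) ^ j
          * rat_fps (1 / (fact i * fact j))) has_sum A) {(i, j). i \<le> j} \<and>
      ((\<lambda>(i, j). uv ^ (i - j - 1) * zv ^ (i + j) * yv ^ i * (yv - 1) ^ j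
          * rat_fps (1 / (fact i * fact j))) has_sum B) {(i, j). j < i} \<and>
      F = (1 + uv) * exp_fps (2 * yv * zv) * (A - B))"
proof -
  have t': "t = zv * expz (lmono 0 [:-2:])"
  proof -
    have "- 2 * zv = zv * fps_const (lmono 0 [:-2:])"
    proof -
      have "lmono 0 [:-2:] = - 2" using single_uminus[of "0 :: int" "[:2:] :: rat poly"] single_pCons_2 by simp
      then have "fps_const (lmono 0 [:-2:]) = - 2" by (simp add: numeral_fps_const)
      then show ?thesis by (simp only: mult.commute)
    qed
    then show ?thesis unfolding t by (simp only: exp_fps_zv)
  qed
  have x': "x = (1 + uv) * expz (lmono 1 (-1))"
  proof -
    have "- (zv * uv) = zv * fps_const (lmono 1 (-1))"
      by (simp add: uv_def single_uminus flip: fps_const_neg)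
    then show ?thesis unfolding x by (simp only: exp_fps_zv)
  qed
  have e: "exp_fps (2 * yv * zv) = expz (lmono 0 [:0, 2:])"
  proof -
    have "lmono 0 [:0, 2:] = 2 * lmono 0 [:0, 1:]"
      by (simp add: mult_single flip: single_pCons_2)
    then have "2 * yv * zv = zv * fps_const (lmono 0 [:0, 2:])"
      by (simp add: yv_def numeral_fps_const mult.commute)
    then show ?thesis by (simp only: exp_fps_zv)
  qed
  interpret specialization t x
  proof
    show "dy x = 0" unfolding x' by (simp add: dy_mult dy_add dy_expz pderiv_minus)
    show "at_y a x = x" for a unfolding x' by (simp add: at_y_mult at_y_add at_y_expz one_pCons)
    have 1: "poly_u (1 + uv)" unfolding uv_def
      by (intro poly_u_add poly_u_1 poly_u_const polynomial_in_u_single) simp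
    have 2: "poly_u (expz (lmono 1 (-1)))" by (intro poly_u_expz polynomial_in_u_single) simp
    show "poly_u x" unfolding x' by (rule poly_u_mult[OF 1 2])
    show "at_u0 x = 1" unfolding x' at_u0_mult[OF 1 2]
      by (simp add: at_u0_add at_u0_uv at_u0_expz polynomial_in_u_single coeff_u0_single)
    have 3: "poly_u zv" by (simp add: zv_def fps_X_def polynomial_in_u_single flip: single_one)
    have 4: "poly_u (expz (lmono 0 [:-2:]))" by (intro poly_u_expz polynomial_in_u_single) simp
    show "dy t = 0" unfolding t' by (simp add: dy_mult dy_expz)
    show "at_y a t = t" for a unfolding t' by (simp add: at_y_mult at_y_expz)
    show "poly_u t" unfolding t' by (rule poly_u_mult[OF 3 4])
    have "at_u0 zv = zv" by (rule fps_ext) (simp add: zv_def fps_X_def)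
    then show "at_u0 t = t" unfolding t' at_u0_mult[OF 3 4]
      by (simp add: at_u0_expz polynomial_in_u_single coeff_u0_single)
    show "fps_nth t 0 = 0" unfolding t' by (simp add: zv_def)
  qed
  have x0: "fps_nth (x - 1) 0 \<noteq> 0"
  proof -
    have "lmono 1 1 \<noteq> 0" by (metis lookup_single_eq lookup_zero zero_neq_one)
    then show ?thesis by (simp add: x' uv_def expz_def)
  qed
  \<comment> \<open>Multiplied by \<open>u\<close>, the right-hand side is \<open>t x (1 + u) e^(2z) (1 + u - e^(zu))\<close>, where \<open>t e^(2z) = z\<close> and \<open>x e^(zu) = 1 + u\<close>.\<close>
  have key: "(x - 1) * (zv * (1 + uv) * (1 + ubar)) = t * (x * at_y 1 tamari_sol)"
  proof -
    have "expz (lmono 0 [:-2:]) * expz (lmono 0 [:2:]) = 1" "expz (lmono 1 (-1)) * expz (lmono 1 1) = 1"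
      by (simp_all flip: expz_add single_add)
    then have *: "x * expz (lmono 1 1) = 1 + uv" "t * expz (lmono 0 [:2:]) = zv"
      unfolding x' t' by (simp_all add: mult.assoc)
    have "uv * (t * (x * at_y 1 tamari_sol)) = t * (x * (uv * at_y 1 tamari_sol))"
      by (simp add: mult_ac)
    also have "\<dots> = (1 + uv) * (t * expz (lmono 0 [:2:])) * (x * (1 + uv) - x * expz (lmono 1 1))"
      unfolding at_y_1_tamari_sol by (simp add: algebra_simps)
    also have "\<dots> = (x - 1) * zv * (1 + uv) * (uv + uv * ubar)"
      unfolding * uv_ubar by (simp add: algebra_simps)
    also have "\<dots> = uv * ((x - 1) * (zv * (1 + uv) * (1 + ubar)))"
      by (simp add: algebra_simps)
    finally have "uv * (t * (x * at_y 1 tamari_sol)) = uv * ((x - 1) * (zv * (1 + uv) * (1 + ubar)))" .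
    moreover have "uv \<noteq> 0" using uv_ubar by auto
    ultimately show ?thesis by simp
  qed
  have "is_solution tamari_sol"
    unfolding is_solution_def
  proof
    show "at_y 0 tamari_sol = x" by (simp add: at_y_0_tamari_sol x')
    show "(x - 1) * dy tamari_sol = t * (x * ((tamari_sol - at_u0 tamari_sol) * at_y 1 tamari_sol))"
      using arg_cong[OF key, of "\<lambda>c. c * (tamari_sol - at_u0 tamari_sol)"]
      by (simp add: dy_tamari_sol mult_ac)
  qed
  then have F: "subst_t (interval_series x) = tamari_sol"
    using solution_unique[OF x0 is_solution_interval_series] by blast
  have sums: "(\<lambda>n. eval_xy x yv (fps_nth tamari_gf n) * t ^ n) sums tamari_sol"
    using subst_t_sums[of "interval_series x"] by (simp only: eval_xy_tamari_gf F)
  have sol: "tamari_sol = (1 + uv) * exp_fps (2 * yv * zv) * kernel_pos"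
    by (simp only: tamari_sol_def e)
  from kernel_pos_series obtain A B where
    A: "((\<lambda>(i, j). uv ^ (j - i) * zv ^ (i + j) * yv ^ i * (yv - 1) ^ j
          * rat_fps (1 / (fact i * fact j))) has_sum A) {(i, j). i \<le> j}" and
    B: "((\<lambda>(i, j). uv ^ (i - j - 1) * zv ^ (i + j) * yv ^ i * (yv - 1) ^ j
          * rat_fps (1 / (fact i * fact j))) has_sum B) {(i, j). j < i}" and
    AB: "kernel_pos = A - B"
    by blast
  show ?thesis
    unfolding kernel_eq kernel_pos_def[symmetric]
    by (rule exI[of _ tamari_sol], intro conjI, rule sums, rule poly_u_tamari_sol, rule sol,
        rule exI[of _ A], rule exI[of _ B], intro conjI, rule A, rule B, rule sol[unfolded AB])
qed

end
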